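(* Let $\mathcal{X}$ be a Polish space, let $\lambda=(\lambda_1,\lambda_2,\ldots)\in\Lambda^\infty$, and let $P$ be the distribution of a $\lambda$-exchangeable sequence $(X_1,X_2,\ldots)$ on $\mathcal{X}^\infty$. Assume that the $\lambda_i$ are bounded continuous functions such that $$r_i:=\frac{\inf_{x\in\mathcal{X}}\lambda_i(x)}{\sup_{x\in\mathcal{X}}\lambda_i(x)}>0\ \text{ for } i=1,2,\ldots,\quad\text{and}\quad \sum_{i=1}^\infty r_i=\infty.$$ Then $P$ is a mixture of weighted i.i.d. distributions on $\mathcal{X}^\infty$ (with respect to the weights $\lambda$).
   Context: $\Lambda$ is the set of measurable functions $\mathcal{X}\to(0,\infty)$, with $\Lambda^n$, $\Lambda^\infty$ the $n$-fold and countably infinite products. $\mathcal{B}$ is the Borel $\sigma$-algebra of $\mathcal{X}$, and $\mathcal{B}^n$, $\mathcal{B}^\infty$ are the Borel $\sigma$-algebras of $\mathcal{X}^n$, $\mathcal{X}^\infty$. A probability measure $P_n$ on $(\mathcal{X}^n,\mathcal{B}^n)$ is called $(\lambda_1,\ldots,\lambda_n)$-exchangeable if the measure $\overline{P}_n$ defined by $\overline{P}_n(B)=\int_B \frac{dP_n(x_1,\ldots,x_n)}{\prod_{i=1}^n\lambda_i(x_i)}$, $B\in\mathcal{B}^n$, is an exchangeable probability measure (i.e. invariant under all permutations of the $n$ coordinates). A probability measure $P$ on $(\mathcal{X}^\infty,\mathcal{B}^\infty)$ (or a random sequence with this distribution) is called $\lambda$-exchangeable, for $\lambda=(\lambda_1,\lambda_2,\ldots)\in\Lambda^\infty$,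 if for every $n\ge1$ its marginal $P_n$ on the first $n$ coordinates is $(\lambda_1,\ldots,\lambda_n)$-exchangeable. For a probability measure $\mu$ on $\mathcal{X}$ and a bounded $\lambda_i\in\Lambda$, let $T_i\mu$ be the probability measure $T_i\mu(dx)=\lambda_i(x)\mu(dx)/\int\lambda_i\,d\mu$. A weighted i.i.d. distribution on $\mathcal{X}^\infty$ is a product measure $\otimes_{i=1}^\infty T_i\mu$. A mixture of weighted i.i.d. distributions on $\mathcal{X}^\infty$ is a measure of the form $\int_{\mathcal{P}(\mathcal{X})}\otimes_{i=1}^\infty T_i\mu\,\Pi(d\mu)$ with $\Pi$ a probability measure on the space $\mathcal{P}(\mathcal{X})$ of probability measures on $\mathcal{X}$ (with the Borel $\sigma$-algebra of the weak topology). *)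

theory Defs
  imports "HOL-Probability.Probability"
begin

text \<open>Coordinates are numbered from 0, so the first \<open>n\<close> coordinates are \<open>{..<n}\<close>. For a
  second countable space the Borel sigma-algebras of \<open>\<X>\<^sup>n\<close> and \<open>\<X>\<^sup>\<infinity>\<close> are the product
  sigma-algebras (cf. \<open>sets_PiM_equal_borel\<close>); the definitions below use the latter.\<close>

abbreviation pow_space :: "nat \<Rightarrow> (nat \<Rightarrow> 'a::topological_space) measure" where
  "pow_space n \<equiv> Pi\<^sub>M {..<n} (\<lambda>_. borel)"

abbreviation seq_space :: "(nat \<Rightarrow> 'a::topological_space) measure" where
  "seq_space \<equiv> Pi\<^sub>M UNIV (\<lambda>_. borel)"

definition weight_funs :: "('a::topological_space \<Rightarrow> real) set" where
  "weight_funs = {f \<in> borel_measurable borel. \<forall>x. f x > 0}"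

definition exchangeable :: "nat \<Rightarrow> (nat \<Rightarrow> 'a::topological_space) measure \<Rightarrow> bool" where
  "exchangeable n Q \<longleftrightarrow> sets Q = sets (pow_space n) \<and>
     (\<forall>\<pi>. \<pi> permutes {..<n} \<longrightarrow> distr Q (pow_space n) (\<lambda>x. \<lambda>i\<in>{..<n}. x (\<pi> i)) = Q)"

definition unweighted ::
    "(nat \<Rightarrow> 'a::topological_space \<Rightarrow> real) \<Rightarrow> nat \<Rightarrow> (nat \<Rightarrow> 'a) measure \<Rightarrow> (nat \<Rightarrow> 'a) measure" where
  "unweighted w n Q = density Q (\<lambda>x. ennreal (1 / (\<Prod>i<n. w i (x i))))"

text \<open>The unweighted measure is required to have total mass 1, not merely to be finite. This fixes
  the scaling of the weights, which is irrelevant for the normalised measures \<open>tilt (w i) \<mu>\<close>.\<close>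

definition weighted_exchangeable_fin ::
    "(nat \<Rightarrow> 'a::topological_space \<Rightarrow> real) \<Rightarrow> nat \<Rightarrow> (nat \<Rightarrow> 'a) measure \<Rightarrow> bool" where
  "weighted_exchangeable_fin w n Q \<longleftrightarrow>
     prob_space Q \<and> sets Q = sets (pow_space n) \<and>
     prob_space (unweighted w n Q) \<and> exchangeable n (unweighted w n Q)"

definition marginal ::
    "nat \<Rightarrow> (nat \<Rightarrow> 'a::topological_space) measure \<Rightarrow> (nat \<Rightarrow> 'a) measure" where
  "marginal n P = distr P (pow_space n) (\<lambda>x. restrict x {..<n})"

definition weighted_exchangeable ::
    "(nat \<Rightarrow> 'a::topological_space \<Rightarrow> real) \<Rightarrow> (nat \<Rightarrow> 'a) measure \<Rightarrow> bool" where
  "weighted_exchangeable w P \<longleftrightarrow>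
     prob_space P \<and> sets P = sets seq_space \<and>
     (\<forall>n\<ge>1. weighted_exchangeable_fin w n (marginal n P))"

definition prob_measures :: "'a::topological_space measure set" where
  "prob_measures = {\<mu>. prob_space \<mu> \<and> sets \<mu> = sets borel}"

text \<open>The coarsest topology on the probability measures making \<open>\<mu> \<mapsto> \<integral>f d\<mu>\<close> continuous for
  every bounded continuous \<open>f\<close>.\<close>

definition weak_topology :: "'a::topological_space measure topology" where
  "weak_topology = topology_generated_by
     {{\<mu> \<in> prob_measures. (\<integral>x. f x \<partial>\<mu>) \<in> U} | (f :: 'a \<Rightarrow> real) U.
        continuous_on UNIV f \<and> bounded (range f) \<and> open U}"

definition weak_borel :: "'a::topological_space measure measure" where
  "weak_borel = sigma (topspace weak_topology) {U. openin weak_topology U}"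

definition tilt :: "('a::topological_space \<Rightarrow> real) \<Rightarrow> 'a measure \<Rightarrow> 'a measure" where
  "tilt f \<mu> = density \<mu> (\<lambda>x. ennreal (f x / (\<integral>y. f y \<partial>\<mu>)))"

definition weighted_iid ::
    "(nat \<Rightarrow> 'a::topological_space \<Rightarrow> real) \<Rightarrow> 'a measure \<Rightarrow> (nat \<Rightarrow> 'a) measure" where
  "weighted_iid w \<mu> = Pi\<^sub>M UNIV (\<lambda>i. tilt (w i) \<mu>)"

text \<open>For bounded weights the integrand is a measurable function of \<open>\<mu>\<close>, so the integral
  below is the usual one.\<close>

definition weighted_iid_mixture ::
    "(nat \<Rightarrow> 'a::topological_space \<Rightarrow> real) \<Rightarrow> (nat \<Rightarrow> 'a) measure \<Rightarrow> bool" where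
  "weighted_iid_mixture w P \<longleftrightarrow>
     sets P = sets seq_space \<and>
     (\<exists>\<Theta>. prob_space \<Theta> \<and> sets \<Theta> = sets weak_borel \<and>
        (\<forall>A\<in>sets seq_space. emeasure P A = (\<integral>\<^sup>+\<mu>. emeasure (weighted_iid w \<mu>) A \<partial>\<Theta>)))"

definition inf_sup_ratio :: "('a \<Rightarrow> real) \<Rightarrow> real" where
  "inf_sup_ratio f = (INF x. f x) / (SUP x. f x)"

end

theory Submission
  imports Defs
begin

text \<open>The mixing measure is read off the sequence itself. Write \<open>X\<^sub>i\<close> for the coordinates,
  \<open>c\<^sub>i = inf w\<^sub>i\<close> and \<open>a\<^sub>i = c\<^sub>i / w\<^sub>i(X\<^sub>i)\<close>, so that \<open>r\<^sub>i \<le> a\<^sub>i \<le> 1\<close>. If the \<open>X\<^sub>i\<close> were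
  independent with laws \<open>tilt (w i) \<mu>\<close>, dividing by the weight would undo the tilt, and the
  averages \<open>N\<^sub>n(f) = (\<Sum>i<n. a\<^sub>i f(X\<^sub>i)) / (\<Sum>i<n. a\<^sub>i)\<close> would converge to \<open>\<integral>f d\<mu>\<close> by the law of
  large numbers: their denominators are at least \<open>\<Sum>i<n. r\<^sub>i\<close>, which tends to infinity. The proof
  establishes such a convergence, along a sequence of indices, from weighted exchangeability.

  The only consequence of weighted exchangeability that enters is that the measure \<open>a\<^sub>i a\<^sub>j dP\<close> is
  invariant under exchanging the coordinates \<open>i\<close> and \<open>j\<close> (\<open>weighted_exchangeable_swap\<close>). Hence
  \<open>E[a\<^sub>i a\<^sub>j f(X\<^sub>i) g(X\<^sub>j) H]\<close> and \<open>E[a\<^sub>i a\<^sub>j g(X\<^sub>i) f(X\<^sub>j) H]\<close> differ only by the effect of the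
  exchange on \<open>H\<close> (\<open>exchange_error\<close>), and expressions in the averages \<open>N\<^sub>n\<close> hardly change when two
  coordinates are exchanged. Summing over \<open>i < n\<close> and \<open>j < m\<close> bounds \<open>E (N\<^sub>n(f) - N\<^sub>m(f))\<^sup>2\<close> by a
  multiple of \<open>1 / (\<Sum>i<min n m. r\<^sub>i)\<close> (\<open>avg_L2_Cauchy\<close>), so that the averages converge almost surely
  along a sparse sequence of indices. Summing over \<open>i < n\<close> for fixed \<open>j\<close> yields, for the limiting
  random measure \<open>\<mu>\<close>, the identity \<open>E[H a\<^sub>j f(X\<^sub>j) \<mu>(g)] = E[H a\<^sub>j g(X\<^sub>j) \<mu>(f)]\<close> whenever \<open>H\<close> is
  unchanged by exchanging \<open>j\<close> with any large index (\<open>directing_exchange\<close>). For \<open>g = w\<^sub>j\<close> the product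
  \<open>a\<^sub>j g(X\<^sub>j)\<close> is the constant \<open>c\<^sub>j\<close>, and the identity says that \<open>X\<^sub>j\<close> has law \<open>tilt (w j) \<mu>\<close> given
  \<open>\<mu>\<close> and finitely many other coordinates (\<open>conditional_law_coordinate\<close>). Replacing the coordinates
  one after the other gives the mixture representation.

  Two constructions make \<open>\<mu>\<close> a random element of the space of probability measures. A Polish space
  is a Borel retract of the real line (\<open>polish_real_code\<close>), so \<open>\<mu>\<close> can be built from a random
  distribution function. And the Borel sets of the weak topology are those generated by the
  evaluations \<open>\<mu> \<mapsto> \<mu>(A)\<close> (\<open>sets_weak_borel\<close>), so the law of \<open>\<mu>\<close> is a measure of the required kind.\<close>

section \<open>The Borel sigma-algebra of the weak topology\<close>

lemma space_prob_algebra_borel: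
  "space (prob_algebra (borel :: 'a::topological_space measure)) = prob_measures"
  by (auto simp: space_prob_algebra prob_measures_def)

lemma topspace_weak_topology:
  "topspace (weak_topology :: 'a::topological_space measure topology) = prob_measures"
proof -
  have "(prob_measures :: 'a measure set) \<in> {{\<mu> \<in> prob_measures. (\<integral>x. f x \<partial>\<mu>) \<in> U} | (f :: 'a \<Rightarrow> real) U.
        continuous_on UNIV f \<and> bounded (range f) \<and> open U}"
    by (rule CollectI, rule exI[of _ "\<lambda>_. 0"], rule exI[of _ UNIV]) auto
  then show ?thesis
    unfolding weak_topology_def topology_generated_by_topspace by blast
qed

lemma space_weak_borel: "space weak_borel = prob_measures"
  by (simp add: weak_borel_def topspace_weak_topology space_measure_of_conv)

lemma sets_weak_borel_sigma: "sets weak_borel = sigma_sets prob_measures {U. openin weak_topology U}"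
proof -
  have "{U. openin weak_topology U} \<subseteq> Pow (topspace weak_topology)"
    using openin_subset by blast
  from sets_measure_of[OF this] show ?thesis
    by (simp add: weak_borel_def topspace_weak_topology)
qed

lemma integral_measurable_weak_borel:
  fixes f :: "'a::topological_space \<Rightarrow> real"
  assumes "continuous_on UNIV f" "bounded (range f)"
  shows "(\<lambda>\<mu>. \<integral>x. f x \<partial>\<mu>) \<in> borel_measurable weak_borel"
proof (rule borel_measurableI)
  fix U :: "real set" assume "open U"
  then have "openin weak_topology {\<mu> \<in> prob_measures. (\<integral>x. f x \<partial>\<mu>) \<in> U}"
    unfolding weak_topology_def using assms by (intro topology_generated_by_Basis) blast
  moreover have "(\<lambda>\<mu>. \<integral>x. f x \<partial>\<mu>) -` U \<inter> space weak_borel = {\<mu> \<in> prob_measures. (\<integral>x. f x \<partial>\<mu>) \<in> U}"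
    by (auto simp: space_weak_borel)
  ultimately show "(\<lambda>\<mu>. \<integral>x. f x \<partial>\<mu>) -` U \<inter> space weak_borel \<in> sets weak_borel"
    by (auto simp: sets_weak_borel_sigma)
qed

text \<open>The indicator of an open set is a pointwise limit of bounded continuous functions, namely of
  truncated multiples of the distance to its complement.\<close>

lemma open_measurable_weak_borel:
  fixes G :: "'a::metric_space set"
  assumes G: "open G"
  shows "(\<lambda>\<mu>. measure \<mu> G) \<in> borel_measurable weak_borel"
proof (cases "G = UNIV")
  case True
  have "measure \<mu> G = 1" if "\<mu> \<in> space weak_borel" for \<mu> :: "'a measure"
  proof -
    from that have p: "prob_space \<mu>" and s: "sets \<mu> = sets borel"
      by (simp_all add: space_weak_borel prob_measures_def)
    show ?thesis using prob_space.prob_space[OF p] sets_eq_imp_space_eq[OF s] True by simp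
  qed
  then show ?thesis by (subst measurable_cong) auto
next
  \<comment> \<open>The case distinction is needed because \<open>infdist\<close> to the empty set is 0.\<close>
  case False
  define f where "f = (\<lambda>n x. min 1 (real n * infdist x (-G)))"
  have cont: "continuous_on UNIV (f n)" for n
    unfolding f_def by (intro continuous_intros)
  have bnd: "norm (f n x) \<le> 1" for n x
    unfolding f_def by (auto simp: infdist_nonneg)
  have lim: "(\<lambda>n. f n x) \<longlonglongrightarrow> indicator G x" for x
  proof (cases "x \<in> G")
    case True
    have "infdist x (-G) > 0"
      using True G False in_closed_iff_infdist_zero[of "-G" x] infdist_nonneg[of x "-G"]
      by (auto simp: closed_Compl less_le)
    then obtain N :: nat where N: "1 < real N * infdist x (-G)"
      using reals_Archimedean3 by blast
    have "f n x = 1" if "n \<ge> N" for n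
    proof -
      have "real N * infdist x (-G) \<le> real n * infdist x (-G)"
        using that by (intro mult_right_mono) (auto simp: infdist_nonneg)
      then show ?thesis using N by (auto simp: f_def)
    qed
    then have "eventually (\<lambda>n. f n x = indicator G x) sequentially"
      using True by (auto simp: eventually_sequentially)
    then show ?thesis by (rule tendsto_eventually)
  next
    case F: False
    then have "infdist x (-G) = 0" by simp
    then show ?thesis using F by (simp add: f_def)
  qed
  show ?thesis
  proof (rule borel_measurable_LIMSEQ_real)
    show "(\<lambda>\<mu>. \<integral>x. f n x \<partial>\<mu>) \<in> borel_measurable weak_borel" for n
      using cont bnd by (intro integral_measurable_weak_borel) (auto simp: bounded_iff)
    fix \<mu> :: "'a measure" assume "\<mu> \<in> space weak_borel"
    then have p: "prob_space \<mu>" and s: "sets \<mu> = sets borel"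
      by (auto simp: space_weak_borel prob_measures_def)
    interpret prob_space \<mu> by fact
    have fm: "f n \<in> borel_measurable \<mu>" for n
      using borel_measurable_continuous_onI[OF cont] s measurable_cong_sets by blast
    have gm: "(indicator G :: 'a \<Rightarrow> real) \<in> borel_measurable \<mu>"
      using G s by (intro borel_measurable_indicator) auto
    have "(\<lambda>n. \<integral>x. f n x \<partial>\<mu>) \<longlonglongrightarrow> (\<integral>x. indicator G x \<partial>\<mu>)"
      using fm gm lim bnd
      by (intro integral_dominated_convergence[where w = "\<lambda>_. 1"]) auto
    then show "(\<lambda>n. \<integral>x. f n x \<partial>\<mu>) \<longlonglongrightarrow> measure \<mu> G"
      using G s by simp
  qed
qed

lemma id_measurable_weak_borel_prob_algebra:
  "(\<lambda>\<mu>. \<mu>) \<in> measurable (weak_borel :: 'a::metric_space measure measure) (prob_algebra borel)"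
proof (rule measurable_prob_algebra_generated)
  show "sets (borel :: 'a measure) = sigma_sets UNIV {S. open S}" by (simp add: borel_def)
  show "Int_stable {S :: 'a set. open S}" by (auto simp: Int_stable_def)
  fix A :: "'a set" assume A: "A \<in> {S. open S}"
  have "emeasure \<mu> A = ennreal (measure \<mu> A)" if "\<mu> \<in> space weak_borel" for \<mu> :: "'a measure"
    using that by (intro finite_measure.emeasure_eq_measure)
      (auto simp: space_weak_borel prob_measures_def prob_space_def)
  then show "(\<lambda>\<mu>. emeasure \<mu> A) \<in> borel_measurable weak_borel"
    using open_measurable_weak_borel[of A] A by (subst measurable_cong) auto
qed (auto simp: space_weak_borel prob_measures_def)

text \<open>When the sets in \<open>F\<close> are taken from a countable base, there are only countably many of these
  functions, and every nonnegative continuous function is approximated from below by them. Inserting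
  \<open>0\<close> makes the maximum meaningful for empty \<open>F\<close>.\<close>

definition rational_step :: "(rat \<times> 'a set) set \<Rightarrow> 'a \<Rightarrow> real" where
  "rational_step F x = Max (insert 0 ((\<lambda>(q, B). of_rat q * indicator B x) ` F))"

lemma rational_step_nonneg: "finite F \<Longrightarrow> 0 \<le> rational_step F x"
  by (simp add: rational_step_def)

lemma rational_step_measurable:
  assumes "finite F" "\<And>q B. (q, B) \<in> F \<Longrightarrow> B \<in> sets M"
  shows "rational_step F \<in> borel_measurable M"
  using assms
proof (induction F rule: finite_induct)
  case empty
  have "rational_step {} = (\<lambda>x :: 'a. 0)" by (auto simp: rational_step_def)
  show ?case unfolding \<open>rational_step {} = _\<close> by simp
next
  case (insert p F)
  obtain q B where p: "p = (q, B)" by force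
  have "rational_step (insert p F) = (\<lambda>x. max (of_rat q * indicator B x) (rational_step F x))"
    using insert.hyps
    by (auto simp: rational_step_def p fun_eq_iff insert_commute[of 0])
  moreover have "rational_step F \<in> borel_measurable M" "B \<in> sets M"
    using insert p by auto
  ultimately show ?case by simp
qed

text \<open>A nonnegative continuous \<open>f\<close> is the supremum of the countably many functions \<open>q 1\<^sub>B \<le> f\<close> with
  rational \<open>q\<close> and basic \<open>B\<close>. The maxima over initial segments of an enumeration increase to \<open>f\<close>, so
  their integrals converge.\<close>

lemma integral_rational_step_approx:
  fixes f :: "'a::topological_space \<Rightarrow> real"
  assumes B: "topological_basis \<B>" "countable \<B>"
    and f: "continuous_on UNIV f" "\<And>x. 0 \<le> f x" "\<And>x. f x \<le> C"
    and \<mu>: "\<mu> \<in> prob_measures" and r: "r < (\<integral>x. f x \<partial>\<mu>)"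
  shows "\<exists>F. finite F \<and> F \<subseteq> UNIV \<times> \<B> \<and> (\<forall>x. rational_step F x \<le> f x) \<and> r < (\<integral>x. rational_step F x \<partial>\<mu>)"
proof -
  interpret prob_space \<mu> using \<mu> by (simp add: prob_measures_def)
  have s: "sets \<mu> = sets borel" using \<mu> by (simp add: prob_measures_def)
  define D where "D = {(q, B). B \<in> \<B> \<and> (\<forall>x. of_rat q * indicator B x \<le> f x)}"
  have Dsub: "D \<subseteq> UNIV \<times> \<B>" by (auto simp: D_def)
  have cD: "countable D" by (rule countable_subset[OF Dsub]) (use B(2) in auto)
  have neD: "D \<noteq> {}"
  proof -
    obtain b where "b \<in> \<B>" using B(1)  by (metis UNIV_I topological_basisE open_UNIV)
    then have "(0, b) \<in> D" using f(2) by (auto simp: D_def)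
    then show ?thesis by blast
  qed
  define d where "d = from_nat_into D"
  have dD: "range d = D" unfolding d_def using cD neD by (rule range_from_nat_into[rotated])
  define g where "g n = rational_step (d ` {..n})" for n
  have g_le: "g n x \<le> f x" for n x
  proof -
    have "(case d i of (q, B) \<Rightarrow> of_rat q * indicator B x) \<le> f x" for i
      using rangeI[of d i] unfolding dD by (auto simp: D_def)
    then show ?thesis using f(2) by (auto simp: g_def rational_step_def)
  qed
  have g_nn: "0 \<le> g n x" for n x by (simp add: g_def rational_step_nonneg)
  have lim: "(\<lambda>n. g n x) \<longlonglongrightarrow> f x" for x
  proof (rule LIMSEQ_I)
    fix e :: real assume e: "e > 0"
    show "\<exists>no. \<forall>n\<ge>no. norm (g n x - f x) < e"
    proof -
      obtain q where q: "f x - e < of_rat q" "of_rat q < f x"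
        using of_rat_dense[of "f x - e" "f x"] e by auto
      have "open {y. of_rat q < f y}"
        using f(1) by (intro open_Collect_less) auto
      then obtain b where b: "b \<in> \<B>" "x \<in> b" "b \<subseteq> {y. of_rat q < f y}"
        using B(1) q(2) by (metis mem_Collect_eq topological_basisE)
      have "(q, b) \<in> D" using b f(2) by (auto simp: D_def indicator_def less_imp_le)
      then obtain N where N: "d N = (q, b)" using dD by (metis imageE)
      have "of_rat q \<le> g n x" if "n \<ge> N" for n
      proof -
        have "(case d N of (q, B) \<Rightarrow> of_rat q * indicator B x)
            \<in> (\<lambda>(q, B). of_rat q * indicator B x :: real) ` d ` {..n}"
          using that by (intro imageI) auto
        then have "of_rat q * indicator b x \<in> (\<lambda>(q, B). of_rat q * indicator B x :: real) ` d ` {..n}"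
          by (simp add: N)
        then show ?thesis using b(2) unfolding g_def rational_step_def
          by (intro Max_ge) auto
      qed
      then have "norm (g n x - f x) < e" if "n \<ge> N" for n
        using g_le[of n x] q(1) that by fastforce
      then show ?thesis by blast
    qed
  qed
  have "(\<lambda>n. \<integral>x. g n x \<partial>\<mu>) \<longlonglongrightarrow> (\<integral>x. f x \<partial>\<mu>)"
  proof (rule integral_dominated_convergence[where w = "\<lambda>_. C"])
    show "f \<in> borel_measurable \<mu>"
      using borel_measurable_continuous_onI[OF f(1)] s measurable_cong_sets by blast
    show "g n \<in> borel_measurable \<mu>" for n
      unfolding g_def using Dsub dD B(1)
      by (intro rational_step_measurable) (force simp: s intro: borel_open topological_basis_open)+
    show "AE x in \<mu>. norm (g n x) \<le> C" for n
      using g_nn[of n] order_trans[OF g_le[of n] f(3)] by (intro AE_I2) simp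
  qed (use lim in auto)
  then have "eventually (\<lambda>n. r < (\<integral>x. g n x \<partial>\<mu>)) sequentially"
    using r by (rule order_tendstoD)
  then obtain n where "r < (\<integral>x. g n x \<partial>\<mu>)" by (auto simp: eventually_sequentially)
  moreover have "d ` {..n} \<subseteq> UNIV \<times> \<B>"
    using dD Dsub by (blast intro: order_trans[OF image_mono])
  ultimately show ?thesis
    using g_le by (intro exI[of _ "d ` {..n}"]) (simp add: g_def)
qed

text \<open>The subbasis that defines the weak topology need not be countable, so the point of the inclusion
  from left to right is second countability. If \<open>\<integral>f d\<mu> > r\<close> for a bounded continuous \<open>f\<close>, this is already
  witnessed by the integral of one of countably many step functions below \<open>f\<close>. Hence every weakly
  open set is a countable union of finite intersections of sets of measures for which such an
  integral exceeds a rational number, and these sets are generated by the evaluations.\<close>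

lemma sets_weak_borel:
  "sets (weak_borel :: 'a::{metric_space, second_countable_topology} measure measure)
    = sets (prob_algebra borel)"
proof
  show "sets (prob_algebra borel) \<subseteq> sets (weak_borel :: 'a measure measure)"
  proof
    fix A :: "'a measure set" assume A: "A \<in> sets (prob_algebra borel)"
    have "(\<lambda>\<mu>. \<mu>) -` A \<inter> space weak_borel \<in> sets weak_borel"
      using id_measurable_weak_borel_prob_algebra A by (rule measurable_sets)
    moreover have "A \<subseteq> space weak_borel"
      using sets.sets_into_space[OF A] by (simp add: space_weak_borel space_prob_algebra_borel)
    ultimately show "A \<in> sets weak_borel" by (simp add: Int_absorb2)
  qed
next
  obtain \<B> :: "'a set set" where \<B>: "countable \<B>" "topological_basis \<B>"
    using ex_countable_basis by blast
  define steps where "steps = {F. finite F \<and> F \<subseteq> (UNIV :: rat set) \<times> \<B>}"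
  define S where "S F q = {\<mu> \<in> prob_measures. of_rat q < (\<integral>x. rational_step F x \<partial>\<mu>)}" for F :: "(rat \<times> 'a set) set" and q
  define \<S> where "\<S> = (\<lambda>(F, q). S F q) ` (steps \<times> UNIV)"
  have "countable steps" unfolding steps_def using \<B>(1) by (intro countable_Collect_finite_subset) auto
  then have c\<S>: "countable \<S>" unfolding \<S>_def by auto
  have meas_\<S>: "A \<in> sets (prob_algebra borel)" if "A \<in> \<S>" for A
  proof -
    from that obtain F q where A: "A = S F q" "finite F" "F \<subseteq> UNIV \<times> \<B>"
      by (auto simp: \<S>_def steps_def)
    have "rational_step F \<in> borel_measurable borel"
      using A \<B>(2) by (intro rational_step_measurable) (auto intro: borel_open topological_basis_open)
    then have [measurable]: "(\<lambda>\<mu>. \<integral>x. rational_step F x \<partial>\<mu>) \<in> borel_measurable (prob_algebra borel)"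
      by (rule measurable_compose[OF measurable_prob_algebraD[OF measurable_ident_sets[OF refl]]
            integral_measurable_subprob_algebra])
    have "{\<mu> \<in> space (prob_algebra borel). of_rat q < (\<integral>x. rational_step F x \<partial>\<mu>)} \<in> sets (prob_algebra borel)"
      by measurable
    then show ?thesis by (simp add: A S_def space_prob_algebra_borel)
  qed
  define nbh where "nbh U \<longleftrightarrow> U \<subseteq> prob_measures \<and>
    (\<forall>\<mu>\<in>U. \<exists>\<F>. finite \<F> \<and> \<F> \<subseteq> \<S> \<and> \<mu> \<in> \<Inter>\<F> \<and> \<Inter>\<F> \<inter> prob_measures \<subseteq> U)" for U
  \<comment> \<open>Adding a bound \<open>C\<close> of \<open>\<bar>f\<bar>\<close> reduces to nonnegative functions.\<close>
  have lsc: "\<exists>A\<in>\<S>. \<mu> \<in> A \<and> A \<subseteq> {\<nu> \<in> prob_measures. r < (\<integral>x. f x \<partial>\<nu>)}"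
    if f: "continuous_on UNIV f" "bounded (range f)" and \<mu>: "\<mu> \<in> prob_measures" and r: "r < (\<integral>x. f x \<partial>\<mu>)"
    for f :: "'a \<Rightarrow> real" and \<mu> r
  proof -
    obtain C where C: "\<And>x. \<bar>f x\<bar> \<le> C" using f(2) by (auto simp: bounded_iff)
    have shift: "integrable \<nu> f \<and> (\<integral>x. f x + C \<partial>\<nu>) = (\<integral>x. f x \<partial>\<nu>) + C" if "\<nu> \<in> prob_measures" for \<nu>
    proof -
      interpret prob_space \<nu> using that by (simp add: prob_measures_def)
      have "f \<in> borel_measurable \<nu>"
        using borel_measurable_continuous_onI[OF f(1)] that measurable_cong_sets
        unfolding prob_measures_def by blast
      then have "integrable \<nu> f" using C by (intro integrable_const_bound[where B = C]) auto
      then show ?thesis by (simp add: prob_space)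
    qed
    have "r + C < (\<integral>x. f x + C \<partial>\<mu>)" using shift[OF \<mu>] r by simp
    then obtain q where q: "r + C < of_rat q" "of_rat q < (\<integral>x. f x + C \<partial>\<mu>)"
      using of_rat_dense by blast
    have "0 \<le> f x + C" "f x + C \<le> 2 * C" for x
      using C[of x] by auto
    note fC = this
    have "continuous_on UNIV (\<lambda>x. f x + C)" using f(1) by (intro continuous_intros)
    from integral_rational_step_approx[OF \<B>(2,1) this fC \<mu> q(2)]
    obtain F where F: "finite F" "F \<subseteq> UNIV \<times> \<B>" "\<And>x. rational_step F x \<le> f x + C"
        "of_rat q < (\<integral>x. rational_step F x \<partial>\<mu>)" by blast
    have "S F q \<in> \<S>" using F by (auto simp: \<S>_def steps_def)
    moreover have "\<mu> \<in> S F q" using F \<mu> by (simp add: S_def)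
    moreover have "r < (\<integral>x. f x \<partial>\<nu>)" if \<nu>: "\<nu> \<in> S F q" for \<nu>
    proof -
      have p: "\<nu> \<in> prob_measures" and "of_rat q < (\<integral>x. rational_step F x \<partial>\<nu>)"
        using \<nu> by (auto simp: S_def)
      interpret prob_space \<nu> using p by (simp add: prob_measures_def)
      have "(\<integral>x. rational_step F x \<partial>\<nu>) \<le> (\<integral>x. f x + C \<partial>\<nu>)"
      proof (rule integral_mono')
        show "integrable \<nu> (\<lambda>x. f x + C)" using shift[OF p] by simp
        show "0 \<le> f x + C" for x by (rule fC)
      qed (use F(3) in auto)
      then show ?thesis using shift[OF p] q \<open>of_rat q < (\<integral>x. rational_step F x \<partial>\<nu>)\<close> by linarith
    qed
    ultimately show ?thesis by (intro bexI[of _ "S F q"]) (auto simp: S_def)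
  qed
  \<comment> \<open>\<open>nbh\<close> holds for the subbasis and is preserved by the operations that generate the topology.\<close>
  have nbh: "nbh U" if "openin weak_topology U" for U :: "'a measure set"
  proof -
    from that have "generate_topology_on {{\<mu> \<in> prob_measures. (\<integral>x. f x \<partial>\<mu>) \<in> U} | (f :: 'a \<Rightarrow> real) U.
        continuous_on UNIV f \<and> bounded (range f) \<and> open U} U"
      unfolding weak_topology_def openin_topology_generated_by_iff .
    then show ?thesis
    proof induction
      case Empty
      then show ?case by (simp add: nbh_def)
    next
      case (Int a b)
      show ?case unfolding nbh_def
      proof (intro conjI ballI)
        show "a \<inter> b \<subseteq> prob_measures" using Int by (auto simp: nbh_def)
        fix \<mu> assume "\<mu> \<in> a \<inter> b"
        then obtain \<F> \<G> where "finite \<F>" "\<F> \<subseteq> \<S>" "\<mu> \<in> \<Inter>\<F>" "\<Inter>\<F> \<inter> prob_measures \<subseteq> a"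
            "finite \<G>" "\<G> \<subseteq> \<S>" "\<mu> \<in> \<Inter>\<G>" "\<Inter>\<G> \<inter> prob_measures \<subseteq> b"
          using Int.IH unfolding nbh_def by (metis IntD1 IntD2)
        then show "\<exists>\<F>. finite \<F> \<and> \<F> \<subseteq> \<S> \<and> \<mu> \<in> \<Inter>\<F> \<and> \<Inter>\<F> \<inter> prob_measures \<subseteq> a \<inter> b"
          by (intro exI[of _ "\<F> \<union> \<G>"]) auto
      qed
    next
      case (UN K)
      show ?case unfolding nbh_def
      proof (intro conjI ballI)
        show "\<Union>K \<subseteq> prob_measures" using UN by (auto simp: nbh_def)
        fix \<mu> assume "\<mu> \<in> \<Union>K"
        then obtain k where k: "k \<in> K" "\<mu> \<in> k" by auto
        then obtain \<F> where "finite \<F>" "\<F> \<subseteq> \<S>" "\<mu> \<in> \<Inter>\<F>" "\<Inter>\<F> \<inter> prob_measures \<subseteq> k"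
          using UN.IH[OF k(1)] unfolding nbh_def by metis
        then show "\<exists>\<F>. finite \<F> \<and> \<F> \<subseteq> \<S> \<and> \<mu> \<in> \<Inter>\<F> \<and> \<Inter>\<F> \<inter> prob_measures \<subseteq> \<Union>K"
          using k by (intro exI[of _ "\<F>"]) auto
      qed
    next
      case (Basis s)
      then obtain f :: "'a \<Rightarrow> real" and V where s: "s = {\<mu> \<in> prob_measures. (\<integral>x. f x \<partial>\<mu>) \<in> V}"
        and f: "continuous_on UNIV f" "bounded (range f)" and V: "open V" by blast
      have f': "continuous_on UNIV (\<lambda>x. - f x)" "bounded (range (\<lambda>x. - f x))"
        using f by (auto intro!: continuous_intros simp: bounded_iff)
      show ?case unfolding nbh_def
      proof (intro conjI ballI)
        show "s \<subseteq> prob_measures" using s by auto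
        fix \<mu> assume "\<mu> \<in> s"
        then have \<mu>: "\<mu> \<in> prob_measures" and "(\<integral>x. f x \<partial>\<mu>) \<in> V" using s by auto
        with V obtain e where e: "e > 0" "\<And>y. dist y (\<integral>x. f x \<partial>\<mu>) < e \<Longrightarrow> y \<in> V"
          by (auto simp: open_dist)
        obtain A where A: "A \<in> \<S>" "\<mu> \<in> A" "A \<subseteq> {\<nu> \<in> prob_measures. (\<integral>x. f x \<partial>\<mu>) - e < (\<integral>x. f x \<partial>\<nu>)}"
          using lsc[OF f \<mu>, of "(\<integral>x. f x \<partial>\<mu>) - e"] e by auto
        obtain A' where A': "A' \<in> \<S>" "\<mu> \<in> A'" "A' \<subseteq> {\<nu> \<in> prob_measures. - (\<integral>x. f x \<partial>\<mu>) - e < - (\<integral>x. f x \<partial>\<nu>)}"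
          using lsc[OF f' \<mu>, of "- (\<integral>x. f x \<partial>\<mu>) - e"] e by auto
        have "A \<inter> A' \<subseteq> s"
        proof
          fix \<nu> assume "\<nu> \<in> A \<inter> A'"
          then have "\<nu> \<in> {\<nu> \<in> prob_measures. (\<integral>x. f x \<partial>\<mu>) - e < (\<integral>x. f x \<partial>\<nu>)}"
              "\<nu> \<in> {\<nu> \<in> prob_measures. - (\<integral>x. f x \<partial>\<mu>) - e < - (\<integral>x. f x \<partial>\<nu>)}"
            using A(3) A'(3) by blast+
          then have "\<nu> \<in> prob_measures" "dist (\<integral>x. f x \<partial>\<nu>) (\<integral>x. f x \<partial>\<mu>) < e"
            by (auto simp: dist_real_def)
          then show "\<nu> \<in> s" using e s by auto
        qed
        then show "\<exists>\<F>. finite \<F> \<and> \<F> \<subseteq> \<S> \<and> \<mu> \<in> \<Inter>\<F> \<and> \<Inter>\<F> \<inter> prob_measures \<subseteq> s"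
          using A A' by (intro exI[of _ "{A, A'}"]) auto
      qed
    qed
  qed
  have "U \<in> sets (prob_algebra borel)" if "openin weak_topology U" for U :: "'a measure set"
  proof -
    define \<U> where "\<U> = {\<F>. (finite \<F> \<and> \<F> \<subseteq> \<S>) \<and> \<Inter>\<F> \<inter> prob_measures \<subseteq> U}"
    have "U = (\<Union>\<F>\<in>\<U>. \<Inter>\<F> \<inter> prob_measures)"
    proof
      show "U \<subseteq> (\<Union>\<F>\<in>\<U>. \<Inter>\<F> \<inter> prob_measures)"
      proof
        fix \<mu> assume "\<mu> \<in> U"
        then have "\<exists>\<F>. finite \<F> \<and> \<F> \<subseteq> \<S> \<and> \<mu> \<in> \<Inter>\<F> \<and> \<Inter>\<F> \<inter> prob_measures \<subseteq> U" "\<mu> \<in> prob_measures"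
          using nbh[OF that] unfolding nbh_def by blast+
        then show "\<mu> \<in> (\<Union>\<F>\<in>\<U>. \<Inter>\<F> \<inter> prob_measures)" unfolding \<U>_def by blast
      qed
    qed (auto simp: \<U>_def)
    moreover have "countable \<U>"
      by (rule countable_subset[OF _ countable_Collect_finite_subset[OF c\<S>]]) (auto simp: \<U>_def)
    moreover have "\<Inter>\<F> \<inter> prob_measures \<in> sets (prob_algebra borel)" if "\<F> \<in> \<U>" for \<F>
    proof -
      have "finite \<F>" "\<F> \<subseteq> \<S>" using that by (auto simp: \<U>_def)
      then show ?thesis
      proof (induction \<F> rule: finite_induct)
        case empty
        show ?case using sets.top[of "prob_algebra (borel :: 'a measure)"]
          by (simp add: space_prob_algebra_borel)
      next
        case (insert A \<F>)
        then have "A \<in> sets (prob_algebra borel)" "\<Inter>\<F> \<inter> prob_measures \<in> sets (prob_algebra borel)"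
          using meas_\<S> by auto
        from sets.Int[OF this]
        show ?case by (simp add: Int_assoc)
      qed
    qed
    ultimately show ?thesis by (metis (no_types, lifting) sets.countable_UN'')
  qed
  then show "sets (weak_borel :: 'a measure measure) \<subseteq> sets (prob_algebra borel)"
    unfolding sets_weak_borel_sigma space_prob_algebra_borel[symmetric]
    by (intro sets.sigma_sets_subset) auto
qed

section \<open>A Borel code for the points of a Polish space\<close>

text \<open>In base 4 with digits 0 and 1, what follows a digit contributes at most a third of the unit of
  that digit. Rounding down therefore recovers the digits, without the ambiguity of binary
  expansions.\<close>

definition binary_code :: "(nat \<Rightarrow> bool) \<Rightarrow> real" where
  "binary_code b = (\<Sum>k. of_bool (b k) * (1/4) ^ Suc k)"

lemma binary_code_summable: "summable (\<lambda>k. of_bool (b k) * (1/4::real) ^ Suc k)"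
  by (rule summable_comparison_test'[OF summable_mult[OF summable_geometric[of "1/4::real"], of "1/4"], of 0])
     (auto simp: of_bool_def)

lemma binary_code_bounds: "0 \<le> binary_code b" "binary_code b \<le> 1/3"
proof -
  show "0 \<le> binary_code b"
    unfolding binary_code_def by (rule suminf_nonneg[OF binary_code_summable]) auto
  have "(\<lambda>k. (1/4) * (1/4::real) ^ k) sums (1/4 * (1 / (1 - 1/4)))"
    by (intro sums_mult geometric_sums) auto
  then have s: "(\<lambda>k. (1/4::real) ^ Suc k) sums (1/3)" by simp
  have "binary_code b \<le> (\<Sum>k. (1/4::real) ^ Suc k)"
    unfolding binary_code_def
    by (rule suminf_le[OF _ binary_code_summable sums_summable[OF s]]) (auto simp: of_bool_def)
  then show "binary_code b \<le> 1/3" using s by (simp add: sums_iff)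
qed

lemma binary_code_digit: "odd \<lfloor>4 ^ Suc k * binary_code b\<rfloor> \<longleftrightarrow> b k"
proof -
  define A :: int where "A = (\<Sum>l\<le>k. of_bool (b l) * 4 ^ (k - l))"
  have A: "odd A \<longleftrightarrow> b k"
  proof -
    have "A = of_bool (b k) + (\<Sum>l<k. of_bool (b l) * 4 ^ (k - l))"
      unfolding A_def by (simp add: lessThan_Suc_atMost[symmetric])
    moreover have "even (\<Sum>l<k. of_bool (b l) * 4 ^ (k - l) :: int)"
      by (rule dvd_sum) auto
    ultimately show ?thesis by simp
  qed
  have "binary_code b = (\<Sum>l. of_bool (b (l + Suc k)) * (1/4) ^ Suc (l + Suc k))
      + (\<Sum>l<Suc k. of_bool (b l) * (1/4) ^ Suc l)"
    unfolding binary_code_def by (rule suminf_split_initial_segment[OF binary_code_summable])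
  also have "(\<Sum>l. of_bool (b (l + Suc k)) * (1/4::real) ^ Suc (l + Suc k))
      = (\<Sum>l. (1/4) ^ Suc k * (of_bool (b (l + Suc k)) * (1/4) ^ Suc l))"
    by (intro suminf_cong) (simp add: power_add)
  also have "\<dots> = (1/4) ^ Suc k * binary_code (\<lambda>l. b (l + Suc k))"
    unfolding binary_code_def by (rule suminf_mult[OF binary_code_summable])
  finally have "4 ^ Suc k * binary_code b = 4 ^ Suc k * (1/4) ^ Suc k * binary_code (\<lambda>l. b (l + Suc k))
      + (\<Sum>l<Suc k. 4 ^ Suc k * (of_bool (b l) * (1/4) ^ Suc l))"
    by (simp add: algebra_simps sum_distrib_left)
  also have "(\<Sum>l<Suc k. 4 ^ Suc k * (of_bool (b l) * (1/4::real) ^ Suc l)) = of_int A"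
    unfolding A_def of_int_sum lessThan_Suc_atMost
  proof (rule sum.cong, rule refl)
    fix l assume "l \<in> {..k}"
    then have "(4::real) ^ k = 4 ^ (k - l) * 4 ^ l" by (simp flip: power_add)
    then show "4 ^ Suc k * (of_bool (b l) * (1/4::real) ^ Suc l) = of_int (of_bool (b l) * 4 ^ (k - l))"
      by (simp add: power_one_over of_bool_def)
  qed
  also have "4 ^ Suc k * (1/4::real) ^ Suc k = 1"
    by (simp add: power_mult_distrib[symmetric] del: power_Suc)
  finally have "4 ^ Suc k * binary_code b = of_int A + binary_code (\<lambda>l. b (l + Suc k))" by simp
  moreover have "0 \<le> binary_code (\<lambda>l. b (l + Suc k))" "binary_code (\<lambda>l. b (l + Suc k)) < 1"
    using binary_code_bounds[of "\<lambda>l. b (l + Suc k)"] by auto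
  ultimately have "\<lfloor>4 ^ Suc k * binary_code b\<rfloor> = A" by (intro floor_unique) auto
  then show ?thesis using A by simp
qed

text \<open>For a dense sequence \<open>q\<close>, the code of \<open>x\<close> lists the answers to all questions whether
  \<open>dist x (q i) < 1 / 2 ^ m\<close>. The decoder selects for each \<open>m\<close> the first \<open>q i\<close> with a positive answer
  and takes the limit over \<open>m\<close>. Reals for which the selected points are not Cauchy are sent to \<open>q 0\<close>;
  this makes the decoder a Borel function on the whole line, whether or not the codes form a Borel
  set.\<close>

lemma polish_real_code:
  obtains \<phi> :: "'a::polish_space \<Rightarrow> real" and \<psi> :: "real \<Rightarrow> 'a"
  where "\<phi> \<in> borel_measurable borel" "\<psi> \<in> measurable borel borel"
    "\<And>x. \<psi> (\<phi> x) = x" "\<And>x. 0 \<le> \<phi> x" "\<And>x. \<phi> x < 1"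
proof -
  obtain D :: "'a set" where D: "countable D" "\<And>X. open X \<Longrightarrow> X \<noteq> {} \<Longrightarrow> \<exists>d\<in>D. d \<in> X"
    using countable_dense_setE by blast
  have "D \<noteq> {}" using D(2)[of UNIV] by auto
  define q where "q = from_nat_into D"
  have q: "range q = D" unfolding q_def using D \<open>D \<noteq> {}\<close> by (intro range_from_nat_into)
  define near where "near x k \<longleftrightarrow> (case prod_decode k of (m, i) \<Rightarrow> dist x (q i) < 1 / 2 ^ m)" for x k
  define \<phi> where "\<phi> x = binary_code (near x)" for x
  define ind where "ind m t = (LEAST i. odd \<lfloor>4 ^ Suc (prod_encode (m, i)) * t\<rfloor>)" for m and t :: real
  define \<psi> where "\<psi> t = (if Cauchy (\<lambda>m. q (ind m t)) then lim (\<lambda>m. q (ind m t)) else q 0)" for t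
  have "\<phi> \<in> borel_measurable borel"
    unfolding \<phi>_def binary_code_def
  proof (rule borel_measurable_suminf)
    fix k
    have "(\<lambda>x. of_bool (near x k) * (1/4) ^ Suc k :: real) = (\<lambda>x. indicator {x. near x k} x * (1/4) ^ Suc k)"
      by (auto simp: indicator_def)
    moreover have "{x. near x k} \<in> sets borel"
      by (cases "prod_decode k")
        (auto simp: near_def intro!: borel_open open_Collect_less continuous_intros)
    ultimately show "(\<lambda>x. of_bool (near x k) * (1/4) ^ Suc k :: real) \<in> borel_measurable borel"
      by simp
  qed
  moreover have "\<psi> \<in> measurable borel borel"
  proof -
    have ind: "ind m \<in> measurable borel (count_space UNIV)" for m
      unfolding ind_def by measurable
    have qi[measurable]: "(\<lambda>t. q (ind m t)) \<in> measurable borel borel" for m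
      by (rule measurable_compose[OF ind]) simp
    have [measurable]: "{t. Cauchy (\<lambda>m. q (ind m t))} \<in> sets borel"
      using sets_Collect_Cauchy[of "\<lambda>m t. q (ind m t)" borel] by simp
    show ?thesis
    proof (rule borel_measurable_LIMSEQ_metric)
      show "(\<lambda>t. if t \<in> {t. Cauchy (\<lambda>m. q (ind m t))} then q (ind m t) else q 0) \<in> borel_measurable borel" for m
        by (rule measurable_If_set) auto
      show "(\<lambda>m. if t \<in> {t. Cauchy (\<lambda>m. q (ind m t))} then q (ind m t) else q 0) \<longlonglongrightarrow> \<psi> t" for t
        by (auto simp: \<psi>_def Cauchy_convergent_iff convergent_LIMSEQ_iff)
    qed
  qed
  moreover have "\<psi> (\<phi> x) = x" for x
  proof -
    have digit: "odd \<lfloor>4 ^ Suc (prod_encode (m, i)) * \<phi> x\<rfloor> \<longleftrightarrow> dist x (q i) < 1 / 2 ^ m" for m i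
      unfolding \<phi>_def binary_code_digit by (simp add: near_def)
    have close: "dist x (q (ind m (\<phi> x))) < 1 / 2 ^ m" for m
    proof -
      have "\<exists>d\<in>D. d \<in> ball x (1 / 2 ^ m)" by (intro D(2)) (simp_all add: not_le)
      then obtain i where "dist x (q i) < 1 / 2 ^ m" using q by (metis imageE mem_ball)
      then show ?thesis unfolding ind_def digit by (rule LeastI)
    qed
    have "(\<lambda>m. dist (q (ind m (\<phi> x))) x) \<longlonglongrightarrow> 0"
    proof (rule tendsto_sandwich[where f = "\<lambda>_. 0" and h = "\<lambda>m. (1/2) ^ m"])
      show "(\<lambda>m. (1/2::real) ^ m) \<longlonglongrightarrow> 0" by (rule LIMSEQ_power_zero) auto
    qed (use close in \<open>auto simp: dist_commute power_one_over less_imp_le\<close>)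
    then have "(\<lambda>m. q (ind m (\<phi> x))) \<longlonglongrightarrow> x" by (rule tendsto_dist_iff[THEN iffD2])
    then show ?thesis using LIMSEQ_imp_Cauchy limI unfolding \<psi>_def by (metis (no_types))
  qed
  moreover have "0 \<le> \<phi> x" "\<phi> x < 1" for x
    using binary_code_bounds[of "near x"] by (auto simp: \<phi>_def)
  ultimately show ?thesis using that by blast
qed

section \<open>Distribution functions and kernels on the real line\<close>

text \<open>The right limit of a monotone function, written as a countable infimum so that it inherits
  measurability in parameters.\<close>

definition right_limit :: "(real \<Rightarrow> real) \<Rightarrow> real \<Rightarrow> real" where
  "right_limit L t = (INF m. L (t + 1 / Suc m))"

lemma
  assumes mono: "mono L" and nonneg: "\<And>t. 0 \<le> L t"
  shows right_limit_LIMSEQ: "(\<lambda>m. L (t + 1 / Suc m)) \<longlonglongrightarrow> right_limit L t"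
    and right_limit_le: "t < u \<Longrightarrow> right_limit L t \<le> L u"
    and le_right_limit: "L t \<le> right_limit L t"
proof -
  have dec: "decseq (\<lambda>m. L (t + 1 / Suc m))" for t
    by (intro decseq_SucI monoD[OF mono]) (auto simp: field_simps)
  have bdd: "bdd_below (range (\<lambda>m. L (t + 1 / Suc m)))" for t
    using nonneg by (intro bdd_belowI2)
  show lim: "(\<lambda>m. L (t + 1 / Suc m)) \<longlonglongrightarrow> right_limit L t"
    unfolding right_limit_def by (rule LIMSEQ_decseq_INF[OF bdd dec])
  show "L t \<le> right_limit L t"
    by (rule LIMSEQ_le_const[OF lim]) (auto intro!: monoD[OF mono])
  assume "t < u"
  then obtain m where "1 / Suc m < u - t"
    using nat_approx_posE[of "u - t"] by auto
  then have "L (t + 1 / Suc m) \<le> L u" by (intro monoD[OF mono]) auto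
  moreover have "right_limit L t \<le> L (t + 1 / Suc m)"
    unfolding right_limit_def by (rule cINF_lower[OF bdd]) auto
  ultimately show "right_limit L t \<le> L u" by linarith
qed

lemma
  assumes mono: "mono L" and nonneg: "\<And>t. 0 \<le> L t"
    and bot: "\<And>t. t < 0 \<Longrightarrow> L t = 0" and top: "\<And>t. 1 \<le> t \<Longrightarrow> L t = 1"
  shows real_distribution_right_limit: "real_distribution (interval_measure (right_limit L))"
    and emeasure_right_limit: "emeasure (interval_measure (right_limit L)) {..t} = ennreal (right_limit L t)"
proof -
  note R = right_limit_LIMSEQ[OF mono nonneg] right_limit_le[OF mono nonneg] le_right_limit[OF mono nonneg]
  have nondec: "right_limit L x \<le> right_limit L y" if "x \<le> y" for x y
    using that R(2)[of x y] R(3)[of y] by (cases "x = y") auto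
  have cont: "continuous (at_right x) (right_limit L)" for x
  proof (subst continuous_at_right_real_increasing[OF nondec], safe)
    fix e :: real assume "0 < e"
    then have "eventually (\<lambda>m. L (x + 1 / Suc m) < right_limit L x + e) sequentially"
      by (intro order_tendstoD(2)[OF R(1)]) auto
    then obtain m where m: "L (x + 1 / Suc m) < right_limit L x + e"
      by (auto simp: eventually_sequentially)
    have "right_limit L (x + 1 / (2 * Suc m)) \<le> L (x + 1 / Suc m)"
      by (intro R(2)) (auto simp: field_simps)
    with m show "\<exists>d>0. right_limit L (x + d) - right_limit L x < e"
      by (intro exI[of _ "1 / (2 * Suc m)"]) auto
  qed
  have "right_limit L t = 0" if "t < 0" for t
    using R(2)[of t "t / 2"] R(3)[of t] bot[of t] bot[of "t / 2"] that by auto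
  then have "eventually (\<lambda>t. right_limit L t = 0) at_bot"
    unfolding eventually_at_bot_linorder by (intro exI[of _ "-1"]) auto
  then have lim_bot: "(right_limit L \<longlongrightarrow> 0) at_bot"
    by (rule tendsto_eventually)
  have "right_limit L t = 1" if "1 \<le> t" for t
    using R(2)[of t "t + 1"] R(3)[of t] top[of t] top[of "t + 1"] that by auto
  then have "eventually (\<lambda>t. right_limit L t = 1) at_top"
    unfolding eventually_at_top_linorder by (intro exI[of _ "1"]) auto
  then have lim_top: "(right_limit L \<longlongrightarrow> 1) at_top"
    by (rule tendsto_eventually)
  show d: "real_distribution (interval_measure (right_limit L))"
    by (rule real_distribution_interval_measure[OF nondec cont lim_bot lim_top])
  interpret d: real_distribution "interval_measure (right_limit L)" by (rule d)
  have "cdf (interval_measure (right_limit L)) = right_limit L"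
    by (rule cdf_interval_measure[OF nondec cont lim_bot])
  then show "emeasure (interval_measure (right_limit L)) {..t} = ennreal (right_limit L t)"
    by (simp add: cdf_def d.emeasure_eq_measure fun_eq_iff)
qed

lemma borel_measure_eqI_atMost:
  fixes M1 M2 :: "real measure"
  assumes "finite_measure M1" "finite_measure M2" "sets M1 = sets borel" "sets M2 = sets borel"
    and eq: "\<And>t. emeasure M1 {..t} = emeasure M2 {..t}"
  shows "M1 = M2"
proof (rule cdf_unique')
  show "finite_borel_measure M1" "finite_borel_measure M2"
    using assms by (auto simp: finite_borel_measure_def finite_borel_measure_axioms_def)
  show "cdf M1 = cdf M2" by (simp add: cdf_def measure_def eq fun_eq_iff)
qed

text \<open>For fixed \<open>f\<close>, the two sides are the integrals of \<open>g\<close> against two measures on the line: the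
  mixture of the kernel \<open>\<nu>\<close> with density \<open>v f(Y)\<close>, and the image under \<open>Y\<close> of the measure with density
  \<open>v \<nu>(f)\<close>. If \<open>f\<close> is the indicator of a half-line, the hypothesis says that they agree on half-lines,
  so they agree on Borel sets. Then \<open>f\<close> may be the indicator of any Borel set by the same argument
  with the roles exchanged, and finally any nonnegative Borel function.\<close>

lemma kernel_symmetric_extend:
  fixes Y :: "'b \<Rightarrow> real" and v :: "'b \<Rightarrow> ennreal" and \<nu> :: "'b \<Rightarrow> real measure"
  assumes M: "finite_measure M" "space M \<noteq> {}"
    and [measurable]: "Y \<in> borel_measurable M" "v \<in> borel_measurable M" and v: "\<And>x. v x \<le> 1"
    and \<nu>: "\<nu> \<in> measurable M (prob_algebra borel)"
    and sym: "\<And>s t. (\<integral>\<^sup>+x. v x * indicator {..t} (Y x) * emeasure (\<nu> x) {..s} \<partial>M)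
      = (\<integral>\<^sup>+x. v x * indicator {..s} (Y x) * emeasure (\<nu> x) {..t} \<partial>M)"
    and f[measurable]: "f \<in> borel_measurable borel" and g[measurable]: "g \<in> borel_measurable borel"
  shows "(\<integral>\<^sup>+x. v x * f (Y x) * (\<integral>\<^sup>+y. g y \<partial>\<nu> x) \<partial>M) = (\<integral>\<^sup>+x. v x * g (Y x) * (\<integral>\<^sup>+y. f y \<partial>\<nu> x) \<partial>M)"
proof -
  have \<nu>s[measurable]: "\<nu> \<in> measurable M (subprob_algebra borel)"
    using \<nu> by (rule measurable_prob_algebraD)
  define J where "J f g = (\<integral>\<^sup>+x. v x * f (Y x) * (\<integral>\<^sup>+y. g y \<partial>\<nu> x) \<partial>M)" for f g
  define m1 where "m1 f = bind (density M (\<lambda>x. v x * f (Y x))) \<nu>" for f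
  define m2 where "m2 f = distr (density M (\<lambda>x. v x * (\<integral>\<^sup>+y. f y \<partial>\<nu> x))) borel Y" for f
  have \<nu>f[measurable]: "(\<lambda>x. \<integral>\<^sup>+y. h y \<partial>\<nu> x) \<in> borel_measurable M" if "h \<in> borel_measurable borel" for h
    using \<nu>s that by (rule measurable_compose[OF _ nn_integral_measurable_subprob_algebra])
  have m1: "(\<integral>\<^sup>+y. h y \<partial>m1 f) = J f h"
    if [measurable]: "f \<in> borel_measurable borel" "h \<in> borel_measurable borel" for f h
    unfolding m1_def J_def by (subst nn_integral_bind[where B = borel]) (auto simp: nn_integral_density)
  have m2: "(\<integral>\<^sup>+y. h y \<partial>m2 f) = J h f"
    if [measurable]: "f \<in> borel_measurable borel" "h \<in> borel_measurable borel" for f h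
    unfolding m2_def J_def by (subst nn_integral_distr) (auto simp: nn_integral_density mult_ac)
  have s1[simp]: "sets (m1 f) = sets borel" if [measurable]: "f \<in> borel_measurable borel" for f
    unfolding m1_def using M(2) subprob_measurableD(2)[OF \<nu>s]
    by (intro sets_bind) (auto simp: space_density)
  have s2[simp]: "sets (m2 f) = sets borel" for f by (simp add: m2_def)
  have e1: "emeasure (m1 f) A = J f (indicator A)"
    if [measurable]: "f \<in> borel_measurable borel" "A \<in> sets borel" for f A
    using m1[of f "indicator A"] by simp
  have e2: "emeasure (m2 f) A = J (indicator A) f"
    if [measurable]: "f \<in> borel_measurable borel" "A \<in> sets borel" for f A
    using m2[of f "indicator A"] by simp
  have \<nu>1: "emeasure (\<nu> x) A \<le> 1" if "x \<in> space M" for x A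
    using prob_space.emeasure_le_1 measurable_space[OF \<nu> that]
    by (auto simp: space_prob_algebra)
  have \<nu>e: "(\<integral>\<^sup>+y. indicator A y \<partial>\<nu> x) = emeasure (\<nu> x) A" if "A \<in> sets borel" "x \<in> space M" for A x
    using that measurable_space[OF \<nu> that(2)] by (simp add: space_prob_algebra)
  have J_fin: "J (indicator A) (indicator B) < \<infinity>" if "A \<in> sets borel" "B \<in> sets borel" for A B
  proof -
    have "J (indicator A) (indicator B) \<le> (\<integral>\<^sup>+x. 1 \<partial>M)"
      unfolding J_def
    proof (intro nn_integral_mono)
      fix x assume "x \<in> space M"
      then show "v x * indicator A (Y x) * (\<integral>\<^sup>+y. indicator B y \<partial>\<nu> x) \<le> 1"
        using \<nu>e[OF that(2)] \<nu>1[of x B] v[of x]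
        by (intro mult_le_one[THEN order_trans] mult_mono[where b = 1 and d = 1, THEN order_trans])
          (auto simp: indicator_def)
    qed
    also have "\<dots> < \<infinity>" using finite_measure.emeasure_finite[OF M(1)] by (simp add: less_top)
    finally show ?thesis .
  qed
  have fin1: "finite_measure (m1 (indicator A))" if "A \<in> sets borel" for A
    using J_fin[OF that, of UNIV] that s1[of "indicator A"] sets_eq_imp_space_eq[of "m1 (indicator A)" borel]
    by (intro finite_measureI) (simp add: e1)
  have fin2: "finite_measure (m2 (indicator A))" if "A \<in> sets borel" for A
    using J_fin[OF _ that, of UNIV] that sets_eq_imp_space_eq[of "m2 (indicator A)" borel]
    by (intro finite_measureI) (simp add: e2)
  have J1: "J (indicator {..t}) (indicator {..s}) = J (indicator {..s}) (indicator {..t})" for s t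
    unfolding J_def using sym[of t s] by (simp add: \<nu>e cong: nn_integral_cong)
  have "m1 (indicator {..t}) = m2 (indicator {..t})" for t
    by (rule borel_measure_eqI_atMost) (simp_all add: fin1 fin2 e1 e2 J1)
  then have J2: "J (indicator {..t}) (indicator A) = J (indicator A) (indicator {..t})" if "A \<in> sets borel" for t A
    using e1[of "indicator {..t}" A] e2[of "indicator {..t}" A] that by simp
  have "m1 (indicator A) = m2 (indicator A)" if "A \<in> sets borel" for A
    using that by (intro borel_measure_eqI_atMost) (simp_all add: fin1 fin2 e1 e2 J2)
  then have J3: "J (indicator A) h = J h (indicator A)"
    if "A \<in> sets borel" "h \<in> borel_measurable borel" for A h
    using m1[of "indicator A" h] m2[of "indicator A" h] that by simp
  have "m1 f = m2 f"
    by (rule measure_eqI) (simp_all add: e1 e2 J3)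
  then have "J f g = J g f" using m1[of f g] m2[of f g] by simp
  then show ?thesis by (simp add: J_def)
qed

section \<open>Exchanging two coordinates of a weighted exchangeable sequence\<close>

text \<open>Dividing only by the weights of \<open>i\<close> and \<open>j\<close> amounts to dividing by all weights and multiplying by
  those of the other coordinates, and the latter product is not affected by the exchange.\<close>

lemma weighted_exchangeable_fin_swap:
  fixes w :: "nat \<Rightarrow> 'a::topological_space \<Rightarrow> real"
  assumes Q: "weighted_exchangeable_fin w n Q"
    and w: "\<And>l. w l \<in> weight_funs" and ij: "i < n" "j < n" "i \<noteq> j"
    and k[measurable]: "k \<in> borel_measurable (pow_space n)"
  shows "(\<integral>\<^sup>+y. ennreal (1 / (w i (y i) * w j (y j))) * k y \<partial>Q)
    = (\<integral>\<^sup>+y. ennreal (1 / (w i (y i) * w j (y j))) *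
          k (\<lambda>l\<in>{..<n}. y (Transposition.transpose i j l)) \<partial>Q)"
proof -
  let ?\<sigma> = "\<lambda>y. \<lambda>l\<in>{..<n}. y (Transposition.transpose i j l)"
  have sQ[measurable_cong]: "sets Q = sets (pow_space n)"
    using Q by (simp add: weighted_exchangeable_fin_def)
  have wm[measurable]: "w l \<in> borel_measurable borel" and wp: "w l x > 0" for l x
    using w by (auto simp: weight_funs_def)
  have perm: "Transposition.transpose i j permutes {..<n}"
    using ij by (intro permutes_swap_id) auto
  define U where "U = unweighted w n Q"
  have sU[measurable_cong]: "sets U = sets (pow_space n)" by (simp add: U_def unweighted_def sQ)
  have dU: "distr U (pow_space n) ?\<sigma> = U"
    using Q perm by (simp add: weighted_exchangeable_fin_def exchangeable_def U_def)
  define R where "R y = (\<Prod>l\<in>{..<n} - {i, j}. w l (y l))" for y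
  have R[measurable]: "R \<in> borel_measurable (pow_space n)"
    unfolding R_def by measurable
  have Rp: "R y > 0" for y unfolding R_def by (intro prod_pos) (auto simp: wp)
  have \<sigma>[measurable]: "?\<sigma> \<in> measurable (pow_space n) (pow_space n)"
    using perm permutes_in_image[OF perm] by (intro measurable_restrict measurable_component_singleton) auto
  have R\<sigma>: "R (?\<sigma> y) = R y" for y
    unfolding R_def by (intro prod.cong) (auto simp: transpose_apply_other)
  have split: "(\<Prod>l<n. w l (y l)) = w i (y i) * w j (y j) * R y" for y
  proof -
    have "(\<Prod>l<n. w l (y l)) = (\<Prod>l\<in>{i, j}. w l (y l)) * R y"
      unfolding R_def using ij by (intro prod.subset_diff[THEN trans[OF _ mult.commute]]) auto
    then show ?thesis using ij by simp
  qed
  have unweight: "(\<integral>\<^sup>+y. ennreal (R y) * h y \<partial>U) = (\<integral>\<^sup>+y. ennreal (1 / (w i (y i) * w j (y j))) * h y \<partial>Q)"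
    if [measurable]: "h \<in> borel_measurable (pow_space n)" for h
  proof -
    have "(\<integral>\<^sup>+y. ennreal (R y) * h y \<partial>U)
        = (\<integral>\<^sup>+y. ennreal (1 / (\<Prod>l<n. w l (y l))) * (ennreal (R y) * h y) \<partial>Q)"
      unfolding U_def unweighted_def by (intro nn_integral_density) measurable
    also have "\<dots> = (\<integral>\<^sup>+y. ennreal (1 / (w i (y i) * w j (y j))) * h y \<partial>Q)"
    proof (intro nn_integral_cong)
      fix y
      have "ennreal (1 / (\<Prod>l<n. w l (y l))) * ennreal (R y) = ennreal (1 / (w i (y i) * w j (y j)))"
        using wp Rp[of y] unfolding split
        by (subst ennreal_mult'[symmetric]) (auto simp: less_imp_le)
      then show "ennreal (1 / (\<Prod>l<n. w l (y l))) * (ennreal (R y) * h y)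
          = ennreal (1 / (w i (y i) * w j (y j))) * h y"
        by (simp add: mult.assoc[symmetric])
    qed
    finally show ?thesis .
  qed
  have "(\<integral>\<^sup>+y. ennreal (R y) * k y \<partial>U) = (\<integral>\<^sup>+y. ennreal (R y) * k y \<partial>distr U (pow_space n) ?\<sigma>)"
    by (simp add: dU)
  also have "\<dots> = (\<integral>\<^sup>+y. ennreal (R y) * k (?\<sigma> y) \<partial>U)"
    by (subst nn_integral_distr) (simp_all add: R\<sigma>)
  finally show ?thesis by (simp add: unweight)
qed

text \<open>Cylinder sets involve finitely many coordinates, which reduces the claim to marginals of
  sufficiently large length. The lower bounds \<open>c\<close> make the measure finite, so that it is
  determined by its values on cylinder sets.\<close>

lemma weighted_exchangeable_swap:
  fixes w :: "nat \<Rightarrow> 'a::topological_space \<Rightarrow> real"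
  assumes P: "weighted_exchangeable w P"
    and w: "\<And>l. w l \<in> weight_funs"
    and c: "\<And>l. c l > 0" "\<And>l x. c l \<le> w l x" and ij: "i \<noteq> j"
  shows "distr (density P (\<lambda>x. ennreal (1 / (w i (x i) * w j (x j))))) seq_space
      (\<lambda>x. x \<circ> Transposition.transpose i j) = density P (\<lambda>x. ennreal (1 / (w i (x i) * w j (x j))))"
proof -
  let ?\<tau> = "Transposition.transpose i j"
  let ?f = "\<lambda>x. ennreal (1 / (w i (x i) * w j (x j)))"
  let ?M = "density P ?f"
  have sP[measurable_cong]: "sets P = sets seq_space" and pP: "prob_space P"
    using P by (auto simp: weighted_exchangeable_def)
  interpret prob_space P by (rule pP)
  have wm[measurable]: "w l \<in> borel_measurable borel" and wp: "w l x > 0" for l x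
    using w by (auto simp: weight_funs_def)
  have \<tau>[measurable]: "(\<lambda>x. x \<circ> ?\<tau>) \<in> measurable seq_space seq_space"
    unfolding comp_def by (rule measurable_PiM_single') auto
  have eq: "emeasure ?M {x. \<forall>l\<in>J. x l \<in> A l} = emeasure ?M {x. \<forall>l\<in>J. x (?\<tau> l) \<in> A l}"
    if J: "finite J" and A[measurable]: "\<And>l. l \<in> J \<Longrightarrow> A l \<in> sets borel" for J A
  proof -
    define n where "n = Suc (Max (J \<union> {i, j}))"
    have n: "l < n" if "l \<in> J \<union> {i, j}" for l
      unfolding n_def less_Suc_eq_le using that J by (intro Max_ge) auto
    have \<tau>n: "?\<tau> l < n" if "l \<in> J" for l
      using that n by (cases "l \<in> {i, j}") auto
    have res[measurable]: "(\<lambda>x. restrict x {..<n}) \<in> measurable seq_space (pow_space n)"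
      by (rule measurable_restrict_subset) auto
    have Q: "weighted_exchangeable_fin w n (marginal n P)"
      using P by (auto simp: weighted_exchangeable_def n_def)
    have marg: "(\<integral>\<^sup>+y. ?f y * k y \<partial>marginal n P) = (\<integral>\<^sup>+x. ?f x * k (restrict x {..<n}) \<partial>P)"
      if [measurable]: "k \<in> borel_measurable (pow_space n)" for k
    proof -
      have [measurable]: "i \<in> {..<n}" "j \<in> {..<n}" using n by auto
      have "(\<integral>\<^sup>+y. ?f y * k y \<partial>marginal n P) = (\<integral>\<^sup>+x. ?f (restrict x {..<n}) * k (restrict x {..<n}) \<partial>P)"
        unfolding marginal_def by (rule nn_integral_distr) measurable
      then show ?thesis using n by simp
    qed
    have [measurable]: "Measurable.pred (pow_space n) (\<lambda>y. \<forall>l\<in>J. y l \<in> A l)"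
    proof -
      have "{y \<in> space (pow_space n). \<forall>l\<in>J. y l \<in> A l} \<in> sets (pow_space n :: (nat \<Rightarrow> 'a) measure)"
        using _ J
      proof (rule sets.sets_Collect_finite_All)
        fix l assume l: "l \<in> J"
        then have [measurable]: "l \<in> {..<n}" using n by auto
        show "{y \<in> space (pow_space n). y l \<in> A l} \<in> sets (pow_space n :: (nat \<Rightarrow> 'a) measure)"
          using A[OF l] by measurable
      qed
      then show ?thesis by (simp add: pred_def)
    qed
    let ?k = "indicator {y. \<forall>l\<in>J. y l \<in> A l} :: (nat \<Rightarrow> 'a) \<Rightarrow> ennreal"
    have k[measurable]: "?k \<in> borel_measurable (pow_space n)" by measurable
    have cyl: "{x. \<forall>l\<in>J. x (p l) \<in> A l} \<in> sets seq_space" for p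
    proof -
      have "{x \<in> space seq_space. \<forall>l\<in>J. x (p l) \<in> A l} \<in> sets (seq_space :: (nat \<Rightarrow> 'a) measure)"
        using _ J
      proof (rule sets.sets_Collect_finite_All)
        show "{x \<in> space seq_space. x (p l) \<in> A l} \<in> sets (seq_space :: (nat \<Rightarrow> 'a) measure)" if "l \<in> J" for l
          using A[OF that] by measurable
      qed
      then show ?thesis by (simp add: space_PiM)
    qed
    note [measurable] = cyl[of "\<lambda>l. l"] cyl[of ?\<tau>]
    have [measurable]: "(\<lambda>y. \<lambda>l\<in>{..<n}. y (?\<tau> l)) \<in> measurable (pow_space n) (pow_space n :: (nat \<Rightarrow> 'a) measure)"
      using permutes_in_image[OF permutes_swap_id[of i "{..<n}" j]] n
      by (intro measurable_restrict measurable_component_singleton) auto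
    have "emeasure ?M {x. \<forall>l\<in>J. x l \<in> A l} = (\<integral>\<^sup>+x. ?f x * ?k (restrict x {..<n}) \<partial>P)"
      using n by (subst emeasure_density) (auto simp: indicator_def intro!: nn_integral_cong)
    also have "\<dots> = (\<integral>\<^sup>+y. ?f y * ?k y \<partial>marginal n P)" by (simp add: marg)
    also have "\<dots> = (\<integral>\<^sup>+y. ?f y * ?k (\<lambda>l\<in>{..<n}. y (?\<tau> l)) \<partial>marginal n P)"
      using n by (intro weighted_exchangeable_fin_swap[OF Q w _ _ ij k]) auto
    also have "\<dots> = (\<integral>\<^sup>+x. ?f x * ?k (\<lambda>l\<in>{..<n}. restrict x {..<n} (?\<tau> l)) \<partial>P)"
      by (rule marg) measurable
    also have "\<dots> = emeasure ?M {x. \<forall>l\<in>J. x (?\<tau> l) \<in> A l}"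
      using n \<tau>n by (subst emeasure_density) (auto simp: indicator_def intro!: nn_integral_cong)
    finally show ?thesis .
  qed
  show ?thesis
  proof (rule sym, rule measure_eqI_PiM_infinite[where I = UNIV and M = "\<lambda>_. borel"])
    fix A and J :: "nat set" assume J: "finite J" and A: "\<And>i. i \<in> J \<Longrightarrow> A i \<in> sets (borel :: 'a measure)"
    have emb: "prod_emb UNIV (\<lambda>_. borel) J (Pi\<^sub>E J A) = {x. \<forall>l\<in>J. x l \<in> A l}"
      by (auto simp: prod_emb_def PiE_iff)
    have "prod_emb UNIV (\<lambda>_. borel) J (Pi\<^sub>E J A) \<in> sets (seq_space :: (nat \<Rightarrow> 'a) measure)"
      using J A by (intro sets_PiM_I) auto
    then have "emeasure (distr ?M seq_space (\<lambda>x. x \<circ> ?\<tau>)) (prod_emb UNIV (\<lambda>_. borel) J (Pi\<^sub>E J A))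
        = emeasure ?M {x. \<forall>l\<in>J. x (?\<tau> l) \<in> A l}"
      by (subst emeasure_distr) (auto simp: emb sets_eq_imp_space_eq[OF sP] space_PiM vimage_def)
    with eq[OF J A]
    show "emeasure ?M (prod_emb UNIV (\<lambda>_. borel) J (Pi\<^sub>E J A)) =
      emeasure (distr ?M seq_space (\<lambda>x. x \<circ> ?\<tau>)) (prod_emb UNIV (\<lambda>_. borel) J (Pi\<^sub>E J A))"
      by (simp add: emb)
  next
    have "1 / (w i x * w j y) \<le> 1 / (c i * c j)" for x y
      using c wp by (intro divide_left_mono mult_mono mult_pos_pos) (auto simp: less_imp_le)
    note f_le = this
    have "emeasure ?M (space ?M) = (\<integral>\<^sup>+x. ?f x \<partial>P)"
      by (subst emeasure_density) (auto intro!: nn_integral_cong simp: indicator_def)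
    also have "\<dots> \<le> (\<integral>\<^sup>+x. ennreal (1 / (c i * c j)) \<partial>P)"
      by (intro nn_integral_mono ennreal_leI f_le)
    also have "\<dots> < \<infinity>" by (simp add: emeasure_space_1)
    finally show "finite_measure ?M" by (intro finite_measureI) auto
  qed (auto simp: sP)
qed

section \<open>Averages with inverse weights\<close>

abbreviation swap_coords :: "nat \<Rightarrow> nat \<Rightarrow> (nat \<Rightarrow> 'a) \<Rightarrow> nat \<Rightarrow> 'a" where
  "swap_coords i j x \<equiv> x \<circ> Transposition.transpose i j"

lemma abs_mult_le: "\<bar>u\<bar> \<le> U \<Longrightarrow> \<bar>v\<bar> \<le> V \<Longrightarrow> \<bar>u * v\<bar> \<le> U * (V :: real)"
  by (simp add: abs_mult mult_mono')

text \<open>The hypothesis on \<open>r\<close> bounds the normalised inverse weights \<open>c i / w i y\<close> from below by \<open>r i\<close>; the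
  optimal choice for \<open>c i\<close> and \<open>r i\<close> is the infimum of \<open>w i\<close> and its ratio to the supremum. Weighted
  exchangeability is represented by the invariance under swaps alone.\<close>

locale swappable_weights = prob_space P
  for P :: "(nat \<Rightarrow> 'a::polish_space) measure" +
  fixes w :: "nat \<Rightarrow> 'a \<Rightarrow> real" and c r :: "nat \<Rightarrow> real"
  assumes sets_P [measurable_cong]: "sets P = sets seq_space"
    and w_measurable [measurable]: "w i \<in> borel_measurable borel"
    and c_pos: "0 < c i" and r_pos: "0 < r i"
    and c_le_w: "c i \<le> w i y" and r_w_le_c: "r i * w i y \<le> c i"
    and r_diverges: "filterlim (\<lambda>n. \<Sum>i<n. r i) at_top sequentially"
    and swap_measure: "i \<noteq> j \<Longrightarrow>
      distr (density P (\<lambda>x. ennreal (1 / (w i (x i) * w j (x j))))) seq_space (swap_coords i j)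
        = density P (\<lambda>x. ennreal (1 / (w i (x i) * w j (x j))))"
begin

lemma w_pos: "0 < w i y"
  using c_pos[of i] c_le_w[of i y] by linarith

definition coef :: "nat \<Rightarrow> 'a \<Rightarrow> real" where "coef i y = c i / w i y"

lemma coef_measurable [measurable]: "coef i \<in> borel_measurable borel"
  unfolding coef_def by measurable

lemma coef_le_1: "coef i y \<le> 1" and r_le_coef: "r i \<le> coef i y" and coef_pos: "0 < coef i y"
  using c_le_w[of i y] r_w_le_c[of i y] w_pos[of i y] c_pos[of i] by (auto simp: coef_def divide_simps)

lemma swap_coords_measurable [measurable]:
  "swap_coords i j \<in> measurable P P"
  "swap_coords i j \<in> measurable seq_space (seq_space :: (nat \<Rightarrow> 'a) measure)"
proof -
  have "swap_coords i j \<in> measurable seq_space (seq_space :: (nat \<Rightarrow> 'a) measure)"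
    unfolding comp_def by (rule measurable_PiM_single') auto
  then show "swap_coords i j \<in> measurable seq_space (seq_space :: (nat \<Rightarrow> 'a) measure)"
    "swap_coords i j \<in> measurable P P"
    using measurable_cong_sets[OF sets_P sets_P] by auto
qed

lemma integral_swap:
  fixes F :: "(nat \<Rightarrow> 'a) \<Rightarrow> real"
  assumes F[measurable]: "F \<in> borel_measurable P"
  shows "(\<integral>x. coef i (x i) * coef j (x j) * F x \<partial>P) = (\<integral>x. coef i (x i) * coef j (x j) * F (swap_coords i j x) \<partial>P)"
proof (cases "i = j")
  case False
  let ?f = "\<lambda>x. 1 / (w i (x i) * w j (x j))"
  have [measurable]: "F \<in> borel_measurable seq_space"
    using F measurable_cong_sets[OF sets_P refl] by blast
  have nn: "0 \<le> ?f x" for x using w_pos[of i "x i"] w_pos[of j "x j"] by simp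
  have "(\<integral>x. ?f x * F x \<partial>P) = (\<integral>x. F x \<partial>density P ?f)"
    using nn by (subst integral_density) auto
  also have "\<dots> = (\<integral>x. F x \<partial>distr (density P ?f) seq_space (swap_coords i j))"
    by (simp add: swap_measure[OF False])
  also have "\<dots> = (\<integral>x. F (swap_coords i j x) \<partial>density P ?f)"
    by (rule integral_distr) measurable
  also have "\<dots> = (\<integral>x. ?f x * F (swap_coords i j x) \<partial>P)"
    using nn by (subst integral_density) auto
  finally have eq: "(\<integral>x. ?f x * F x \<partial>P) = (\<integral>x. ?f x * F (swap_coords i j x) \<partial>P)" .
  have a: "coef i (x i) * coef j (x j) * y = (c i * c j) * (?f x * y)" for x y
    by (simp add: coef_def)
  show ?thesis unfolding a integral_mult_right_zero eq ..
qed simp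

lemma bounded_integrable:
  fixes F :: "(nat \<Rightarrow> 'a) \<Rightarrow> real"
  assumes "F \<in> borel_measurable P" "\<And>x. \<bar>F x\<bar> \<le> B"
  shows "integrable P F"
  using assms by (intro integrable_const_bound[where B = B]) auto

text \<open>In a single term of the double sum, exchanging the coordinates \<open>i\<close> and \<open>j\<close> turns
  \<open>g (x i) * h (x j)\<close> into \<open>g (x j) * h (x i)\<close> and leaves the factor \<open>coef i (x i) * coef j (x j)\<close> to the
  invariant measure. Only the change of \<open>H\<close> remains as an error.\<close>

lemma exchange_error:
  fixes g h :: "'a \<Rightarrow> real" and H :: "(nat \<Rightarrow> 'a) \<Rightarrow> real"
  assumes [measurable]: "g \<in> borel_measurable borel" "h \<in> borel_measurable borel" "H \<in> borel_measurable P"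
    and g: "\<And>y. \<bar>g y\<bar> \<le> 1" and h: "\<And>y. \<bar>h y\<bar> \<le> 1" and H: "\<And>x. \<bar>H x\<bar> \<le> B"
    and IJ: "finite I" "finite J"
    and err: "\<And>x. (\<Sum>i\<in>I. \<Sum>j\<in>J. coef i (x i) * coef j (x j) * \<bar>H (swap_coords i j x) - H x\<bar>) \<le> e"
  shows "\<bar>(\<integral>x. (\<Sum>i\<in>I. coef i (x i) * g (x i)) * (\<Sum>j\<in>J. coef j (x j) * h (x j)) * H x \<partial>P)
    - (\<integral>x. (\<Sum>i\<in>I. coef i (x i) * h (x i)) * (\<Sum>j\<in>J. coef j (x j) * g (x j)) * H x \<partial>P)\<bar> \<le> e"
proof -
  have aa: "\<bar>coef i y * coef j z\<bar> \<le> 1" for i j y z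
    using abs_mult_le[of "coef i y" 1 "coef j z" 1] coef_le_1 coef_pos by (simp add: less_imp_le abs_of_pos)
  have gh: "\<bar>g y * h z\<bar> \<le> 1" for y z
    using abs_mult_le[OF g[of y] h[of z]] by simp
  have int1: "integrable P (\<lambda>x. coef i (x i) * coef j (x j) * (g (x p) * h (x q) * H x))" for i j p q
    using abs_mult_le[OF aa abs_mult_le[OF gh H]] by (intro bounded_integrable) auto
  have int2: "integrable P (\<lambda>x. coef i (x i) * coef j (x j) * (g (x p) * h (x q) * H (swap_coords i j x)))" for i j p q
    using abs_mult_le[OF aa abs_mult_le[OF gh H]] by (intro bounded_integrable) auto
  have "\<bar>H (swap_coords i j x) - H x\<bar> \<le> 2 * B" for i j x
    using H[of x] H[of "swap_coords i j x"] by linarith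
  then have int3: "integrable P (\<lambda>x. coef i (x i) * coef j (x j) * \<bar>H (swap_coords i j x) - H x\<bar>)" for i j
    by (intro bounded_integrable[where B = "1 * (2 * B)"] abs_mult_le aa) auto
  have pair: "\<bar>(\<integral>x. coef i (x i) * coef j (x j) * (g (x i) * h (x j) * H x) \<partial>P)
      - (\<integral>x. coef i (x i) * coef j (x j) * (g (x j) * h (x i) * H x) \<partial>P)\<bar>
      \<le> (\<integral>x. coef i (x i) * coef j (x j) * \<bar>H (swap_coords i j x) - H x\<bar> \<partial>P)" for i j
  proof -
    have "(\<integral>x. coef i (x i) * coef j (x j) * (g (x i) * h (x j) * H x) \<partial>P)
        - (\<integral>x. coef i (x i) * coef j (x j) * (g (x j) * h (x i) * H x) \<partial>P)
      = (\<integral>x. coef i (x i) * coef j (x j) * (g (x j) * h (x i) * H (swap_coords i j x)) \<partial>P)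
        - (\<integral>x. coef i (x i) * coef j (x j) * (g (x j) * h (x i) * H x) \<partial>P)"
      by (subst integral_swap) auto
    also have "\<dots> = (\<integral>x. coef i (x i) * coef j (x j) * (g (x j) * h (x i)) * (H (swap_coords i j x) - H x) \<partial>P)"
      using int1 int2 by (subst Bochner_Integration.integral_diff[symmetric]) (auto simp: algebra_simps)
    finally have "\<bar>(\<integral>x. coef i (x i) * coef j (x j) * (g (x i) * h (x j) * H x) \<partial>P)
        - (\<integral>x. coef i (x i) * coef j (x j) * (g (x j) * h (x i) * H x) \<partial>P)\<bar>
      \<le> (\<integral>x. \<bar>coef i (x i) * coef j (x j) * (g (x j) * h (x i)) * (H (swap_coords i j x) - H x)\<bar> \<partial>P)"
      by (simp only: integral_abs_bound)
    also have "\<dots> \<le> (\<integral>x. coef i (x i) * coef j (x j) * \<bar>H (swap_coords i j x) - H x\<bar> \<partial>P)"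
    proof (rule integral_mono'[OF int3])
      fix x
      have "0 \<le> coef i (x i) * coef j (x j)" using coef_pos by (simp add: less_imp_le)
      then show "\<bar>coef i (x i) * coef j (x j) * (g (x j) * h (x i)) * (H (swap_coords i j x) - H x)\<bar>
          \<le> coef i (x i) * coef j (x j) * \<bar>H (swap_coords i j x) - H x\<bar>"
        using gh[of "x j" "x i"] unfolding abs_mult[of _ "_ - _"] abs_mult[of "_ * _" "_ * _"]
        by (intro mult_right_mono) (simp_all add: mult_left_le)
      show "0 \<le> coef i (x i) * coef j (x j) * \<bar>H (swap_coords i j x) - H x\<bar>"
        using coef_pos by (simp add: less_imp_le)
    qed
    finally show ?thesis .
  qed
  have expand1: "(\<Sum>i\<in>I. coef i (x i) * g (x i)) * (\<Sum>j\<in>J. coef j (x j) * h (x j)) * H x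
      = (\<Sum>i\<in>I. \<Sum>j\<in>J. coef i (x i) * coef j (x j) * (g (x i) * h (x j) * H x))" for x
    unfolding sum_product by (simp add: sum_distrib_left mult_ac)
  have expand2: "(\<Sum>i\<in>I. coef i (x i) * h (x i)) * (\<Sum>j\<in>J. coef j (x j) * g (x j)) * H x
      = (\<Sum>i\<in>I. \<Sum>j\<in>J. coef i (x i) * coef j (x j) * (g (x j) * h (x i) * H x))" for x
    unfolding sum_product by (simp add: sum_distrib_left mult_ac)
  have "\<bar>(\<integral>x. (\<Sum>i\<in>I. coef i (x i) * g (x i)) * (\<Sum>j\<in>J. coef j (x j) * h (x j)) * H x \<partial>P)
    - (\<integral>x. (\<Sum>i\<in>I. coef i (x i) * h (x i)) * (\<Sum>j\<in>J. coef j (x j) * g (x j)) * H x \<partial>P)\<bar>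
    = \<bar>\<Sum>i\<in>I. \<Sum>j\<in>J. (\<integral>x. coef i (x i) * coef j (x j) * (g (x i) * h (x j) * H x) \<partial>P)
      - (\<integral>x. coef i (x i) * coef j (x j) * (g (x j) * h (x i) * H x) \<partial>P)\<bar>"
    unfolding expand1 expand2
    by (subst (1 2) Bochner_Integration.integral_sum) (auto intro!: Bochner_Integration.integrable_sum int1
        simp: Bochner_Integration.integral_sum int1 sum_subtractf)
  also have "\<dots> \<le> (\<Sum>i\<in>I. \<Sum>j\<in>J. (\<integral>x. coef i (x i) * coef j (x j) * \<bar>H (swap_coords i j x) - H x\<bar> \<partial>P))"
    by (intro order_trans[OF sum_abs] sum_mono pair)
  also have "\<dots> = (\<integral>x. (\<Sum>i\<in>I. \<Sum>j\<in>J. coef i (x i) * coef j (x j) * \<bar>H (swap_coords i j x) - H x\<bar>) \<partial>P)"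
    by (subst Bochner_Integration.integral_sum) (auto intro!: Bochner_Integration.integrable_sum int3
        simp: Bochner_Integration.integral_sum int3)
  also have "\<dots> \<le> (\<integral>x. e \<partial>P)"
    by (intro integral_mono err Bochner_Integration.integrable_sum int3) auto
  finally show ?thesis by (simp add: prob_space)
qed

definition r_sum :: "nat \<Rightarrow> real" where "r_sum n = (\<Sum>i<n. r i)"

definition coef_sum :: "nat \<Rightarrow> (nat \<Rightarrow> 'a) \<Rightarrow> real" where "coef_sum n x = (\<Sum>i<n. coef i (x i))"

text \<open>Under the product of the measures \<open>tilt (w i) \<mu>\<close>, dividing by \<open>w i\<close> undoes the tilt, and these
  averages converge to the integral of \<open>g\<close> with respect to \<open>\<mu>\<close>.\<close>

definition avg :: "nat \<Rightarrow> ('a \<Rightarrow> real) \<Rightarrow> (nat \<Rightarrow> 'a) \<Rightarrow> real" where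
  "avg n g x = (\<Sum>i<n. coef i (x i) * g (x i)) / coef_sum n x"

lemma coef_sum_measurable [measurable]: "coef_sum n \<in> borel_measurable P"
  unfolding coef_sum_def by measurable

lemma avg_measurable [measurable]:
  assumes [measurable]: "g \<in> borel_measurable borel" shows "avg n g \<in> borel_measurable P"
  unfolding avg_def by measurable

lemma r_sum_le_coef_sum: "r_sum n \<le> coef_sum n x"
  unfolding r_sum_def coef_sum_def by (intro sum_mono r_le_coef)

lemma avg_bounds:
  assumes "\<And>y. 0 \<le> g y" "\<And>y. g y \<le> 1"
  shows "0 \<le> avg n g x" "avg n g x \<le> 1"
proof -
  have "0 \<le> coef_sum n x" unfolding coef_sum_def by (intro sum_nonneg) (simp add: coef_pos less_imp_le)
  then show "0 \<le> avg n g x" unfolding avg_def using assms coef_pos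
    by (intro divide_nonneg_nonneg sum_nonneg) (auto simp: less_imp_le)
  have "(\<Sum>i<n. coef i (x i) * g (x i)) \<le> coef_sum n x"
    unfolding coef_sum_def using assms coef_pos by (intro sum_mono mult_left_le) (auto simp: less_imp_le)
  then show "avg n g x \<le> 1" unfolding avg_def using \<open>0 \<le> coef_sum n x\<close>
    by (auto simp: divide_le_eq_1 less_le)
qed

text \<open>At most two of the summands change.\<close>

lemma sum_swap_coords:
  assumes f: "\<And>l y. 0 \<le> f l y" "\<And>l y. f l y \<le> (1::real)"
  shows "\<bar>(\<Sum>l<n. f l (swap_coords i j x l)) - (\<Sum>l<n. f l (x l))\<bar> \<le> 2"
proof -
  have "(\<Sum>l<n. f l (swap_coords i j x l)) - (\<Sum>l<n. f l (x l))
      = (\<Sum>l<n. f l (swap_coords i j x l) - f l (x l))" by (simp add: sum_subtractf)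
  also have "\<dots> = (\<Sum>l\<in>{..<n} \<inter> {i, j}. f l (swap_coords i j x l) - f l (x l))"
    by (intro sum.mono_neutral_right) (auto simp: transpose_apply_other)
  finally have "\<bar>(\<Sum>l<n. f l (swap_coords i j x l)) - (\<Sum>l<n. f l (x l))\<bar>
      = \<bar>\<Sum>l\<in>{..<n} \<inter> {i, j}. f l (swap_coords i j x l) - f l (x l)\<bar>" by (rule arg_cong)
  also have "\<dots> \<le> (\<Sum>l\<in>{..<n} \<inter> {i, j}. 1)"
  proof (intro order_trans[OF sum_abs] sum_mono)
    fix l
    show "\<bar>f l (swap_coords i j x l) - f l (x l)\<bar> \<le> 1"
      using f[of l "x l"] f[of l "swap_coords i j x l"] by linarith
  qed
  also have "\<dots> = real (card ({..<n} \<inter> {i, j}))" by simp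
  also have "\<dots> \<le> real (card {i, j})" by (intro of_nat_mono card_mono) auto
  also have "\<dots> \<le> 2" using card_insert_le_m1[of 2 "{j}" i] by simp
  finally show ?thesis .
qed

lemma coef_sum_ratio:
  assumes "0 < r_sum n"
  shows "\<bar>coef_sum n x / coef_sum n (swap_coords i j x) - 1\<bar> \<le> 2 / r_sum n"
proof -
  have pos: "0 < coef_sum n (swap_coords i j x)" using assms r_sum_le_coef_sum[of n "swap_coords i j x"] by linarith
  have "\<bar>coef_sum n (swap_coords i j x) - coef_sum n x\<bar> \<le> 2"
    unfolding coef_sum_def using coef_le_1 coef_pos by (intro sum_swap_coords) (auto simp: less_imp_le)
  then have "\<bar>coef_sum n x - coef_sum n (swap_coords i j x)\<bar> / coef_sum n (swap_coords i j x) \<le> 2 / coef_sum n (swap_coords i j x)"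
    using pos by (intro divide_right_mono) auto
  moreover have "coef_sum n x / coef_sum n (swap_coords i j x) - 1
      = (coef_sum n x - coef_sum n (swap_coords i j x)) / coef_sum n (swap_coords i j x)"
    using pos by (simp add: diff_divide_distrib)
  ultimately have "\<bar>coef_sum n x / coef_sum n (swap_coords i j x) - 1\<bar> \<le> 2 / coef_sum n (swap_coords i j x)"
    using pos by simp
  also have "\<dots> \<le> 2 / r_sum n" using assms r_sum_le_coef_sum[of n "swap_coords i j x"] by (intro divide_left_mono) auto
  finally show ?thesis .
qed

lemma avg_swap:
  assumes n: "0 < r_sum n" and g: "\<And>y. 0 \<le> g y" "\<And>y. g y \<le> 1"
  shows "\<bar>avg n g (swap_coords i j x) - avg n g x\<bar> \<le> 4 / r_sum n"
proof -
  define x' where "x' = swap_coords i j x"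
  define A where "A x = (\<Sum>l<n. coef l (x l) * g (x l))" for x :: "nat \<Rightarrow> 'a"
  have pos: "0 < coef_sum n x'" "0 < coef_sum n x" using n r_sum_le_coef_sum[of n x'] r_sum_le_coef_sum[of n x] by linarith+
  have "\<bar>A x' - A x\<bar> \<le> 2"
    unfolding A_def x'_def using coef_le_1 coef_pos g
    by (intro sum_swap_coords[of "\<lambda>l y. coef l y * g y"]) (auto simp: less_imp_le intro: mult_le_one)
  then have 1: "\<bar>(A x' - A x) / coef_sum n x'\<bar> \<le> 2 / r_sum n"
    using n r_sum_le_coef_sum[of n x'] pos unfolding abs_divide by (intro frac_le) auto
  have "\<bar>avg n g x * (coef_sum n x / coef_sum n x' - 1)\<bar> \<le> 1 * (2 / r_sum n)"
    using avg_bounds[of g n x, OF g] coef_sum_ratio[OF n, of x i j] by (intro abs_mult_le) (auto simp: x'_def)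
  moreover have "avg n g x' - avg n g x = (A x' - A x) / coef_sum n x' + avg n g x * (coef_sum n x / coef_sum n x' - 1)"
  proof -
    have "avg n g x = A x / coef_sum n x" "avg n g x' = A x' / coef_sum n x'" by (simp_all add: avg_def A_def)
    then show ?thesis using pos by (simp add: field_simps)
  qed
  moreover have "4 / r_sum n = 2 / r_sum n + 2 / r_sum n" by simp
  ultimately show ?thesis using 1 unfolding x'_def[symmetric] by linarith
qed

text \<open>Let \<open>H = avg n g / (coef_sum n * coef_sum m)\<close>. Exchanging the functions \<open>g\<close> and \<open>1\<close> in the
  double sum over \<open>i < n\<close> and \<open>j < m\<close> against \<open>H\<close> turns \<open>avg n g * avg n g\<close> into \<open>avg n g * avg m g\<close>.
  A swap changes each factor of \<open>H\<close> by a relative or absolute error of order \<open>1 / e\<close>, and the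
  coefficients in the double sum add up to \<open>coef_sum n * coef_sum m\<close>, so the total error is again of
  order \<open>1 / e\<close>.\<close>

lemma avg_square_close:
  assumes e: "1 \<le> e" "e \<le> r_sum n" "e \<le> r_sum m"
    and [measurable]: "g \<in> borel_measurable borel" and g: "\<And>y. 0 \<le> g y" "\<And>y. g y \<le> 1"
  shows "\<bar>(\<integral>x. avg n g x * avg n g x \<partial>P) - (\<integral>x. avg n g x * avg m g x \<partial>P)\<bar> \<le> 12 / e"
proof -
  define H where "H x = avg n g x / (coef_sum n x * coef_sum m x)" for x
  have S: "e \<le> coef_sum n x" "e \<le> coef_sum m x" for x
    using e r_sum_le_coef_sum[of n x] r_sum_le_coef_sum[of m x] by auto
  have S0: "0 < coef_sum n x" "0 < coef_sum m x" for x using S[of x] e by auto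
  have H_swap: "\<bar>H (swap_coords i j x) - H x\<bar> \<le> (12 / e) / (coef_sum n x * coef_sum m x)" for i j x
  proof -
    define x' where "x' = swap_coords i j x"
    define \<alpha> where "\<alpha> = coef_sum n x / coef_sum n x' - 1"
    define \<beta> where "\<beta> = coef_sum m x / coef_sum m x' - 1"
    have \<alpha>: "\<bar>\<alpha>\<bar> \<le> 2 / e"
      using coef_sum_ratio[of n x i j, THEN order_trans, of "2 / e"] e unfolding \<alpha>_def x'_def
      by (simp add: frac_le)
    have \<beta>: "\<bar>\<beta>\<bar> \<le> 2 / e"
      using coef_sum_ratio[of m x i j, THEN order_trans, of "2 / e"] e unfolding \<beta>_def x'_def
      by (simp add: frac_le)
    have N: "\<bar>avg n g x' - avg n g x\<bar> \<le> 4 / e"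
      using avg_swap[of n g x i j, THEN order_trans, of "4 / e"] e g unfolding x'_def
      by (simp add: frac_le)
    have "\<bar>\<alpha> * \<beta>\<bar> \<le> (2 / e) * 2"
    proof (rule abs_mult_le[OF \<alpha>])
      have "2 / e \<le> 2" using e by (simp add: divide_le_eq)
      then show "\<bar>\<beta>\<bar> \<le> 2" using \<beta> by linarith
    qed
    then have "\<bar>\<alpha> * \<beta> + \<alpha> + \<beta>\<bar> \<le> 8 / e" using \<alpha> \<beta> by (simp add: field_simps)
    moreover have "\<bar>avg n g x'\<bar> \<le> 1" using avg_bounds[of g n x', OF g] by simp
    ultimately have "\<bar>avg n g x' * (\<alpha> * \<beta> + \<alpha> + \<beta>)\<bar> \<le> 1 * (8 / e)" by (intro abs_mult_le)
    then have *: "\<bar>(avg n g x' - avg n g x) + avg n g x' * (\<alpha> * \<beta> + \<alpha> + \<beta>)\<bar> \<le> 12 / e"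
      using N by (simp add: field_simps)
    have ab: "\<alpha> * \<beta> + \<alpha> + \<beta> = (coef_sum n x * coef_sum m x) / (coef_sum n x' * coef_sum m x') - 1"
      using S0[of x'] by (simp add: \<alpha>_def \<beta>_def field_simps)
    have "H x' - H x = ((avg n g x' - avg n g x) + avg n g x' * (\<alpha> * \<beta> + \<alpha> + \<beta>)) / (coef_sum n x * coef_sum m x)"
      unfolding ab using S0[of x] S0[of x'] by (simp add: H_def field_simps)
    then have "\<bar>H x' - H x\<bar> = \<bar>(avg n g x' - avg n g x) + avg n g x' * (\<alpha> * \<beta> + \<alpha> + \<beta>)\<bar> / (coef_sum n x * coef_sum m x)"
      using S0[of x] by (simp add: abs_mult)
    also have "\<dots> \<le> (12 / e) / (coef_sum n x * coef_sum m x)"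
      using * S0[of x] by (intro divide_right_mono) auto
    finally show ?thesis by (simp add: x'_def)
  qed
  have "\<bar>(\<integral>x. (\<Sum>i<n. coef i (x i) * g (x i)) * (\<Sum>j<m. coef j (x j) * 1) * H x \<partial>P)
    - (\<integral>x. (\<Sum>i<n. coef i (x i) * 1) * (\<Sum>j<m. coef j (x j) * g (x j)) * H x \<partial>P)\<bar> \<le> 12 / e"
  proof (rule exchange_error[where B = 1])
    show "H \<in> borel_measurable P" unfolding H_def by measurable
    show "\<bar>H x\<bar> \<le> 1" for x
    proof -
      have "1 * 1 \<le> coef_sum n x * coef_sum m x" using S[of x] e by (intro mult_mono) auto
      then show ?thesis using avg_bounds[of g n x, OF g] S0[of x]
        by (simp add: H_def divide_le_eq)
    qed
    show "(\<Sum>i<n. \<Sum>j<m. coef i (x i) * coef j (x j) * \<bar>H (swap_coords i j x) - H x\<bar>) \<le> 12 / e" for x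
    proof -
      have total: "(\<Sum>i<n. \<Sum>j<m. coef i (x i) * coef j (x j) * C) = coef_sum n x * coef_sum m x * C" for C
        unfolding coef_sum_def sum_product by (simp only: sum_distrib_right)
      have "(\<Sum>i<n. \<Sum>j<m. coef i (x i) * coef j (x j) * \<bar>H (swap_coords i j x) - H x\<bar>)
          \<le> (\<Sum>i<n. \<Sum>j<m. coef i (x i) * coef j (x j) * ((12 / e) / (coef_sum n x * coef_sum m x)))"
        by (intro sum_mono mult_left_mono H_swap) (simp add: coef_pos less_imp_le)
      also have "\<dots> = (coef_sum n x * coef_sum m x) * ((12 / e) / (coef_sum n x * coef_sum m x))"
        by (rule total)
      also have "\<dots> = 12 / e" using S0[of x] by simp
      finally show ?thesis .
    qed
  qed (use g in auto)
  moreover have "(\<Sum>i<n. coef i (x i) * g (x i)) * (\<Sum>j<m. coef j (x j) * 1) * H x = avg n g x * avg n g x" for x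
    using S0[of x] by (simp add: H_def avg_def coef_sum_def[symmetric])
  moreover have "(\<Sum>i<n. coef i (x i) * 1) * (\<Sum>j<m. coef j (x j) * g (x j)) * H x = avg n g x * avg m g x" for x
    using S0[of x] by (simp add: H_def avg_def coef_sum_def[symmetric])
  ultimately show ?thesis by simp
qed

text \<open>The expanded square is the sum of two differences of the kind just estimated, one for each order
  of \<open>n\<close> and \<open>m\<close>.\<close>

lemma avg_L2_Cauchy:
  assumes e: "1 \<le> e" "e \<le> r_sum n" "e \<le> r_sum m"
    and [measurable]: "g \<in> borel_measurable borel" and g: "\<And>y. 0 \<le> g y" "\<And>y. g y \<le> 1"
  shows "(\<integral>x. (avg n g x - avg m g x)\<^sup>2 \<partial>P) \<le> 24 / e"
proof -
  have int: "integrable P (\<lambda>x. avg p g x * avg q g x)" for p q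
    using avg_bounds[of g, OF g] by (intro bounded_integrable[where B = 1]) (auto simp: abs_mult intro!: mult_le_one)
  have "(\<integral>x. (avg n g x - avg m g x)\<^sup>2 \<partial>P)
      = (\<integral>x. (avg n g x * avg n g x - avg n g x * avg m g x) + (avg m g x * avg m g x - avg m g x * avg n g x) \<partial>P)"
    by (intro Bochner_Integration.integral_cong) (auto simp: power2_eq_square algebra_simps)
  also have "\<dots> = ((\<integral>x. avg n g x * avg n g x \<partial>P) - (\<integral>x. avg n g x * avg m g x \<partial>P))
      + ((\<integral>x. avg m g x * avg m g x \<partial>P) - (\<integral>x. avg m g x * avg n g x \<partial>P))"
    using int by (simp add: mult.commute[of "avg m g _" "avg n g _"])
  also have "\<dots> \<le> 12 / e + 12 / e"
    using avg_square_close[OF e assms(4) g] avg_square_close[OF e(1,3,2) assms(4) g] by (simp only: abs_le_iff) linarith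
  finally show ?thesis by simp
qed

text \<open>Along indices for which \<open>r_sum\<close> grows geometrically, the increments of the averages have
  summable expected absolute values, hence are almost surely absolutely summable.\<close>

lemma AE_convergent_avg:
  assumes nk: "\<And>k. 4 ^ k \<le> r_sum (nk k)"
    and [measurable]: "g \<in> borel_measurable borel" and g: "\<And>y. 0 \<le> g y" "\<And>y. g y \<le> 1"
  shows "AE x in P. convergent (\<lambda>k. avg (nk k) g x)"
proof -
  define d where "d k x = avg (nk (Suc k)) g x - avg (nk k) g x" for k x
  have [measurable]: "d k \<in> borel_measurable P" for k unfolding d_def by measurable
  have d1: "\<bar>d k x\<bar> \<le> 1" for k x
    using avg_bounds[of g "nk (Suc k)" x, OF g] avg_bounds[of g "nk k" x, OF g] by (auto simp: d_def)
  have sq: "(\<integral>x. (d k x)\<^sup>2 \<partial>P) \<le> 24 / 4 ^ k" for k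
    unfolding d_def
  proof (rule avg_L2_Cauchy)
    show "4 ^ k \<le> r_sum (nk (Suc k))" using nk[of "Suc k"] by (simp add: order_trans[rotated])
  qed (use nk g in auto)
  have int_sq: "integrable P (\<lambda>x. (d k x)\<^sup>2)" for k
    using d1 by (intro bounded_integrable[where B = 1]) (auto simp: abs_square_le_1)
  have int: "integrable P (\<lambda>x. \<bar>d k x\<bar>)" for k
    using d1 by (intro bounded_integrable[where B = 1]) auto
  have L1: "(\<integral>x. \<bar>d k x\<bar> \<partial>P) \<le> 25 * (1 / 2) ^ k" for k
  proof -
    \<comment> \<open>\<open>\<bar>d\<bar> \<le> e + d\<^sup>2 / e\<close> for \<open>e = (1 / 2) ^ k\<close> passes from second to first moments.\<close>
    have "\<bar>d k x\<bar> \<le> (1 / 2) ^ k + 2 ^ k * (d k x)\<^sup>2" for x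
    proof -
      have "0 \<le> ((1 / 2) ^ k - \<bar>d k x\<bar>)\<^sup>2 + (1 / 2) ^ k * \<bar>d k x\<bar>" by simp
      also have "\<dots> = (1 / 2) ^ k * ((1 / 2) ^ k - \<bar>d k x\<bar>) + (d k x)\<^sup>2"
        by (simp add: power2_eq_square algebra_simps)
      finally have "0 \<le> 2 ^ k * ((1 / 2) ^ k * ((1 / 2) ^ k - \<bar>d k x\<bar>) + (d k x)\<^sup>2)" by simp
      also have "\<dots> = (2 ^ k * (1 / 2) ^ k) * ((1 / 2) ^ k - \<bar>d k x\<bar>) + 2 ^ k * (d k x)\<^sup>2"
        by (simp add: algebra_simps)
      also have "(2::real) ^ k * (1 / 2) ^ k = 1" by (simp flip: power_mult_distrib)
      finally show ?thesis by simp
    qed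
    then have "(\<integral>x. \<bar>d k x\<bar> \<partial>P) \<le> (\<integral>x. (1 / 2) ^ k + 2 ^ k * (d k x)\<^sup>2 \<partial>P)"
      using int int_sq by (intro integral_mono) auto
    also have "\<dots> = (1 / 2) ^ k + 2 ^ k * (\<integral>x. (d k x)\<^sup>2 \<partial>P)"
      using int_sq by (simp add: prob_space)
    also have "\<dots> \<le> (1 / 2) ^ k + 2 ^ k * (24 / 4 ^ k)"
      using sq[of k] by (intro add_left_mono mult_left_mono) auto
    also have "(2::real) ^ k * (24 / 4 ^ k) = 24 * (1 / 2) ^ k"
      by (simp add: power_divide flip: power_mult_distrib) (simp add: field_simps flip: power_mult_distrib)
    finally show ?thesis by simp
  qed
  have "(\<integral>\<^sup>+x. (\<Sum>k. ennreal \<bar>d k x\<bar>) \<partial>P) = (\<Sum>k. \<integral>\<^sup>+x. ennreal \<bar>d k x\<bar> \<partial>P)"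
    by (rule nn_integral_suminf) measurable
  also have "\<dots> \<le> (\<Sum>k. ennreal (25 * (1 / 2) ^ k))"
    using L1 int by (intro suminf_le summableI) (auto simp: nn_integral_eq_integral intro!: ennreal_leI)
  also have "\<dots> = ennreal (\<Sum>k. 25 * (1 / 2) ^ k)"
    by (intro suminf_ennreal2) (auto intro!: summable_mult summable_geometric)
  also have "\<dots> < \<infinity>" by simp
  finally have "AE x in P. (\<Sum>k. ennreal \<bar>d k x\<bar>) \<noteq> \<infinity>"
    by (intro nn_integral_PInf_AE) auto
  then show ?thesis
  proof (rule AE_mp, intro AE_I2 impI)
    fix x assume "(\<Sum>k. ennreal \<bar>d k x\<bar>) \<noteq> \<infinity>"
    then have "summable (\<lambda>k. \<bar>d k x\<bar>)" by (intro summable_suminf_not_top) auto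
    then have "summable (\<lambda>k. d k x)" by (rule summable_rabs_cancel)
    then have "convergent (\<lambda>n. \<Sum>k<n. d k x)" by (simp add: summable_iff_convergent)
    moreover have "(\<Sum>k<n. d k x) = avg (nk n) g x - avg (nk 0) g x" for n
      unfolding d_def by (rule sum_lessThan_telescope)
    ultimately have "convergent (\<lambda>n. (avg (nk n) g x - avg (nk 0) g x) + avg (nk 0) g x)"
      by (intro convergent_add convergent_const) simp
    then show "convergent (\<lambda>k. avg (nk k) g x)" by simp
  qed
qed

text \<open>The exchange of \<open>g\<close> and \<open>h\<close> between a fixed coordinate \<open>j\<close> and an average. The function \<open>H\<close> may
  change when \<open>j\<close> is swapped with one of the first \<open>m\<close> coordinates, but each of these contributes at
  most \<open>4 / r_sum n\<close> to the error.\<close>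

lemma avg_exchange_coordinate:
  fixes g h :: "'a \<Rightarrow> real" and H :: "(nat \<Rightarrow> 'a) \<Rightarrow> real"
  assumes [measurable]: "g \<in> borel_measurable borel" "h \<in> borel_measurable borel" "H \<in> borel_measurable P"
    and g: "\<And>y. 0 \<le> g y" "\<And>y. g y \<le> 1" and h: "\<And>y. 0 \<le> h y" "\<And>y. h y \<le> 1"
    and H: "\<And>x. \<bar>H x\<bar> \<le> 1" and inv: "\<And>i x. m \<le> i \<Longrightarrow> H (swap_coords i j x) = H x"
    and n: "1 \<le> r_sum n"
  shows "\<bar>(\<integral>x. H x * coef j (x j) * g (x j) * avg n h x \<partial>P)
    - (\<integral>x. H x * coef j (x j) * h (x j) * avg n g x \<partial>P)\<bar> \<le> (2 + 4 * real m) / r_sum n"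
proof -
  have S0: "0 < coef_sum n x" "r_sum n \<le> coef_sum n x" for x using n r_sum_le_coef_sum[of n x] by auto
  have diff: "\<bar>H (swap_coords i j x) / coef_sum n (swap_coords i j x) - H x / coef_sum n x\<bar>
      \<le> ((if i < m then 4 else 0) + 2 / r_sum n) / coef_sum n x" for i x
  proof -
    let ?x' = "swap_coords i j x"
    have ratio: "\<bar>coef_sum n x / coef_sum n ?x' - 1\<bar> \<le> 2 / r_sum n" using n by (intro coef_sum_ratio) auto
    have "\<bar>H ?x' * (coef_sum n x / coef_sum n ?x' - 1)\<bar> \<le> 1 * (2 / r_sum n)"
      by (rule abs_mult_le[OF H ratio])
    moreover have "\<bar>H ?x' - H x\<bar> \<le> (if i < m then 4 else 0)"
      using inv[of i x] H[of x] H[of ?x'] by (auto simp: not_less)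
    ultimately have *: "\<bar>H ?x' * (coef_sum n x / coef_sum n ?x' - 1) + (H ?x' - H x)\<bar> \<le> (if i < m then 4 else 0) + 2 / r_sum n"
      by linarith
    have "H ?x' / coef_sum n ?x' - H x / coef_sum n x = (H ?x' * (coef_sum n x / coef_sum n ?x' - 1) + (H ?x' - H x)) / coef_sum n x"
      using S0(1)[of x] S0(1)[of ?x'] by (simp add: field_simps)
    then have "\<bar>H ?x' / coef_sum n ?x' - H x / coef_sum n x\<bar> = \<bar>H ?x' * (coef_sum n x / coef_sum n ?x' - 1) + (H ?x' - H x)\<bar> / coef_sum n x"
      using S0(1)[of x] by simp
    then show ?thesis using * S0(1)[of x] by (simp add: divide_right_mono)
  qed
  have "\<bar>(\<integral>x. (\<Sum>i<n. coef i (x i) * h (x i)) * (\<Sum>l\<in>{j}. coef l (x l) * g (x l)) * (H x / coef_sum n x) \<partial>P)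
    - (\<integral>x. (\<Sum>i<n. coef i (x i) * g (x i)) * (\<Sum>l\<in>{j}. coef l (x l) * h (x l)) * (H x / coef_sum n x) \<partial>P)\<bar>
    \<le> (2 + 4 * real m) / r_sum n"
  proof (rule exchange_error[where B = 1])
    show "\<bar>H x / coef_sum n x\<bar> \<le> 1" for x
      using H[of x] S0[of x] n by (simp add: divide_le_eq)
    show "(\<Sum>i<n. \<Sum>l\<in>{j}. coef i (x i) * coef l (x l) *
        \<bar>H (swap_coords i l x) / coef_sum n (swap_coords i l x) - H x / coef_sum n x\<bar>) \<le> (2 + 4 * real m) / r_sum n" for x
    proof -
      have "(\<Sum>i<n. (if i < m then 4 / r_sum n else 0)) = (\<Sum>i\<in>{..<n} \<inter> {..<m}. 4 / r_sum n)"
        by (subst sum.inter_restrict) auto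
      also have "\<dots> \<le> (\<Sum>i\<in>{..<m}. 4 / r_sum n)"
        using n by (intro sum_mono2) auto
      finally have few: "(\<Sum>i<n. (if i < m then 4 / r_sum n else 0)) \<le> 4 * real m / r_sum n"
        by (simp add: mult.commute)
      have "(\<Sum>i<n. \<Sum>l\<in>{j}. coef i (x i) * coef l (x l) *
          \<bar>H (swap_coords i l x) / coef_sum n (swap_coords i l x) - H x / coef_sum n x\<bar>)
        \<le> (\<Sum>i<n. (if i < m then 4 / r_sum n else 0) + coef i (x i) * ((2 / r_sum n) / coef_sum n x))"
      proof (intro sum_mono)
        fix i
        have "coef i (x i) * coef j (x j) * \<bar>H (swap_coords i j x) / coef_sum n (swap_coords i j x) - H x / coef_sum n x\<bar>
          \<le> coef i (x i) * (((if i < m then 4 else 0) + 2 / r_sum n) / coef_sum n x)"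
          using coef_le_1[of j "x j"] coef_pos[of j "x j"] coef_pos[of i "x i"]
          by (intro mult_mono diff mult_left_le) (auto simp: less_imp_le)
        also have "\<dots> = coef i (x i) * ((if i < m then 4 else 0) / coef_sum n x) + coef i (x i) * ((2 / r_sum n) / coef_sum n x)"
          by (simp add: add_divide_distrib distrib_left)
        also have "coef i (x i) * ((if i < m then 4 else 0) / coef_sum n x) \<le> 1 * (if i < m then 4 / r_sum n else 0)"
          using coef_le_1[of i "x i"] coef_pos[of i "x i"] S0[of x] n
          by (intro mult_mono) (auto intro!: divide_left_mono)
        finally show "(\<Sum>l\<in>{j}. coef i (x i) * coef l (x l) *
            \<bar>H (swap_coords i l x) / coef_sum n (swap_coords i l x) - H x / coef_sum n x\<bar>)
          \<le> (if i < m then 4 / r_sum n else 0) + coef i (x i) * ((2 / r_sum n) / coef_sum n x)" by simp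
      qed
      also have "\<dots> = (\<Sum>i<n. (if i < m then 4 / r_sum n else 0)) + coef_sum n x * ((2 / r_sum n) / coef_sum n x)"
        unfolding coef_sum_def by (simp only: sum.distrib sum_distrib_right)
      also have "coef_sum n x * ((2 / r_sum n) / coef_sum n x) = 2 / r_sum n" using S0[of x] by simp
      also have "(\<Sum>i<n. (if i < m then 4 / r_sum n else 0)) + 2 / r_sum n \<le> (2 + 4 * real m) / r_sum n"
        using few by (simp add: add_divide_distrib)
      finally show ?thesis .
    qed
  qed (use g h in auto)
  moreover have "(\<Sum>i<n. coef i (x i) * h (x i)) * (\<Sum>l\<in>{j}. coef l (x l) * g (x l)) * (H x / coef_sum n x)
      = H x * coef j (x j) * g (x j) * avg n h x" for h g x
    by (simp add: avg_def)
  ultimately show ?thesis by simp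
qed

lemma r_sum_unbounded: "\<exists>n. C \<le> r_sum n"
  using r_diverges unfolding r_sum_def filterlim_at_top by (auto simp: eventually_sequentially)

end

section \<open>Tilted measures and their products\<close>

lemma
  fixes f :: "'a::topological_space \<Rightarrow> real"
  assumes f[measurable]: "f \<in> borel_measurable borel" and c: "0 < c" "\<And>y. c \<le> f y" and C: "\<And>y. f y \<le> C"
    and \<mu>: "\<mu> \<in> space (prob_algebra borel)"
  shows integral_weight_bounds: "c \<le> (\<integral>y. f y \<partial>\<mu>)" "(\<integral>y. f y \<partial>\<mu>) \<le> C"
    and nn_integral_weight: "(\<integral>\<^sup>+y. ennreal (f y) \<partial>\<mu>) = ennreal (\<integral>y. f y \<partial>\<mu>)"
    and emeasure_tilt: "A \<in> sets borel \<Longrightarrow> emeasure (tilt f \<mu>) A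
      = ennreal (1 / (\<integral>y. f y \<partial>\<mu>)) * (\<integral>\<^sup>+y. ennreal (f y) * indicator A y \<partial>\<mu>)"
    and prob_space_tilt: "prob_space (tilt f \<mu>)"
proof -
  have p: "prob_space \<mu>" and s[measurable_cong]: "sets \<mu> = sets borel"
    using \<mu> by (auto simp: space_prob_algebra)
  interpret prob_space \<mu> by (rule p)
  have nonneg: "0 \<le> f y" for y using c(1) c(2)[of y] by linarith
  have int: "integrable \<mu> f"
    using C nonneg by (intro integrable_const_bound[where B = C]) auto
  show W: "c \<le> (\<integral>y. f y \<partial>\<mu>)" "(\<integral>y. f y \<partial>\<mu>) \<le> C"
    using integral_mono[OF integrable_const int, of c] integral_mono[OF int integrable_const, of C] c C
    by (auto simp: prob_space)
  show nn: "(\<integral>\<^sup>+y. ennreal (f y) \<partial>\<mu>) = ennreal (\<integral>y. f y \<partial>\<mu>)"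
    using int nonneg by (simp add: nn_integral_eq_integral)
  have em: "emeasure (tilt f \<mu>) A = ennreal (1 / (\<integral>y. f y \<partial>\<mu>)) * (\<integral>\<^sup>+y. ennreal (f y) * indicator A y \<partial>\<mu>)"
    if A[measurable]: "A \<in> sets borel" for A
  proof -
    have "emeasure (tilt f \<mu>) A = (\<integral>\<^sup>+y. ennreal (f y / (\<integral>y. f y \<partial>\<mu>)) * indicator A y \<partial>\<mu>)"
      unfolding tilt_def by (rule emeasure_density) (use s A in auto)
    also have "\<dots> = (\<integral>\<^sup>+y. ennreal (1 / (\<integral>y. f y \<partial>\<mu>)) * (ennreal (f y) * indicator A y) \<partial>\<mu>)"
      using nonneg c(1) W(1)
      by (intro nn_integral_cong) (simp add: mult.assoc[symmetric] ennreal_mult'[symmetric])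
    also have "\<dots> = ennreal (1 / (\<integral>y. f y \<partial>\<mu>)) * (\<integral>\<^sup>+y. ennreal (f y) * indicator A y \<partial>\<mu>)"
      by (rule nn_integral_cmult) measurable
    finally show ?thesis .
  qed
  then show "A \<in> sets borel \<Longrightarrow> emeasure (tilt f \<mu>) A
      = ennreal (1 / (\<integral>y. f y \<partial>\<mu>)) * (\<integral>\<^sup>+y. ennreal (f y) * indicator A y \<partial>\<mu>)" .
  have "emeasure (tilt f \<mu>) UNIV = 1"
    using em[of UNIV] nn c(1) W(1) by (simp add: ennreal_mult'[symmetric])
  moreover have "space (tilt f \<mu>) = UNIV"
    using sets_eq_imp_space_eq[OF s] by (simp add: tilt_def)
  ultimately show "prob_space (tilt f \<mu>)" by (intro prob_spaceI) simp
qed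

lemma sets_tilt [simp]: "sets (tilt f \<mu>) = sets \<mu>"
  by (simp add: tilt_def)

lemma tilt_measurable:
  fixes f :: "'a::topological_space \<Rightarrow> real"
  assumes f[measurable]: "f \<in> borel_measurable borel" and c: "0 < c" "\<And>y. c \<le> f y" and C: "\<And>y. f y \<le> C"
  shows "tilt f \<in> measurable (prob_algebra borel) (prob_algebra borel)"
proof (rule measurable_prob_algebraI)
  show "prob_space (tilt f \<mu>)" if "\<mu> \<in> space (prob_algebra borel)" for \<mu>
    by (rule prob_space_tilt[OF f c C that])
  have id[measurable]: "(\<lambda>\<mu>. \<mu>) \<in> measurable (prob_algebra borel) (subprob_algebra (borel :: 'a measure))"
    by (rule measurable_prob_algebraD) (rule measurable_ident_sets[OF refl])
  show "tilt f \<in> measurable (prob_algebra borel) (subprob_algebra borel)"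
  proof (rule measurable_subprob_algebra)
    show "subprob_space (tilt f \<mu>)" if "\<mu> \<in> space (prob_algebra borel)" for \<mu>
      using prob_space_tilt[OF f c C that] by (rule prob_space_imp_subprob_space)
    show "sets (tilt f \<mu>) = sets borel" if "\<mu> \<in> space (prob_algebra borel)" for \<mu>
      using that by (simp add: space_prob_algebra)
    fix A :: "'a set" assume A[measurable]: "A \<in> sets borel"
    have [measurable]: "(\<lambda>\<mu>. \<integral>y. f y \<partial>\<mu>) \<in> borel_measurable (prob_algebra borel)"
      by (rule measurable_compose[OF id integral_measurable_subprob_algebra]) measurable
    have [measurable]: "(\<lambda>\<mu>. \<integral>\<^sup>+y. ennreal (f y) * indicator A y \<partial>\<mu>) \<in> borel_measurable (prob_algebra borel)"
      by (rule measurable_compose[OF id nn_integral_measurable_subprob_algebra]) measurable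
    have "(\<lambda>\<mu>. ennreal (1 / (\<integral>y. f y \<partial>\<mu>)) * (\<integral>\<^sup>+y. ennreal (f y) * indicator A y \<partial>\<mu>))
        \<in> borel_measurable (prob_algebra borel)" by measurable
    then show "(\<lambda>\<mu>. emeasure (tilt f \<mu>) A) \<in> borel_measurable (prob_algebra borel)"
      by (subst measurable_cong[OF emeasure_tilt[OF f c C _ A]])
  qed
qed

lemma emeasure_PiM_cylinder:
  assumes "\<And>i. prob_space (M i)" "finite J" "\<And>i. i \<in> J \<Longrightarrow> A i \<in> sets (M i)"
  shows "emeasure (Pi\<^sub>M UNIV M) (prod_emb UNIV M J (Pi\<^sub>E J A)) = (\<Prod>i\<in>J. emeasure (M i) (A i))"
proof -
  interpret product_prob_space M UNIV using assms(1)
    by (intro product_prob_spaceI) auto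
  show ?thesis using assms by (intro emeasure_PiM_emb) auto
qed

lemma weighted_iid_measurable:
  fixes w :: "nat \<Rightarrow> 'a::topological_space \<Rightarrow> real"
  assumes w: "\<And>i. w i \<in> borel_measurable borel" and c: "\<And>i. 0 < c i" "\<And>i y. c i \<le> w i y" and C: "\<And>i y. w i y \<le> C i"
  shows "weighted_iid w \<in> measurable (prob_algebra borel) (prob_algebra seq_space)"
proof (rule measurable_prob_algebra_generated)
  show "sets (seq_space :: (nat \<Rightarrow> 'a) measure)
      = sigma_sets (Pi\<^sub>E UNIV (\<lambda>_. space borel)) (prod_algebra UNIV (\<lambda>_. borel))"
    by (rule sets_PiM)
  show "Int_stable (prod_algebra UNIV (\<lambda>_::nat. borel :: 'a measure))"
    by (rule Int_stable_prod_algebra)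
  show "prod_algebra UNIV (\<lambda>_::nat. borel :: 'a measure) \<subseteq> Pow (Pi\<^sub>E UNIV (\<lambda>_. space borel))"
    by (rule prod_algebra_sets_into_space)
  note tp = prob_space_tilt[OF w c C]
  have st: "sets (tilt (w i) \<mu>) = sets borel" if "\<mu> \<in> space (prob_algebra borel)" for i \<mu>
    using that by (simp add: space_prob_algebra)
  show "prob_space (weighted_iid w \<mu>)" if "\<mu> \<in> space (prob_algebra borel)" for \<mu>
    unfolding weighted_iid_def using tp[OF that] by (intro prob_space_PiM) auto
  show "sets (weighted_iid w \<mu>) = sets seq_space" if "\<mu> \<in> space (prob_algebra borel)" for \<mu>
    unfolding weighted_iid_def using st[OF that] by (intro sets_PiM_cong) auto
  fix B :: "(nat \<Rightarrow> 'a) set" assume "B \<in> prod_algebra UNIV (\<lambda>_. borel)"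
  then obtain J A where B: "B = prod_emb UNIV (\<lambda>_. borel) J (Pi\<^sub>E J A)" "finite J"
      and A: "\<And>i. i \<in> J \<Longrightarrow> A i \<in> sets borel"
    by (rule prod_algebraE) auto
  have "emeasure (weighted_iid w \<mu>) B = (\<Prod>i\<in>J. emeasure (tilt (w i) \<mu>) (A i))"
    if \<mu>: "\<mu> \<in> space (prob_algebra borel)" for \<mu>
  proof -
    have "B = prod_emb UNIV (\<lambda>i. tilt (w i) \<mu>) J (Pi\<^sub>E J A)"
      using sets_eq_imp_space_eq[OF st[OF \<mu>]] by (simp add: B prod_emb_def)
    then show ?thesis
      unfolding weighted_iid_def using tp[OF \<mu>] B(2) A st[OF \<mu>] by (simp add: emeasure_PiM_cylinder)
  qed
  moreover have "(\<lambda>\<mu>. emeasure (tilt (w i) \<mu>) (A i)) \<in> borel_measurable (prob_algebra borel)" if "i \<in> J" for i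
    using measurable_prob_algebraD[OF tilt_measurable[OF w c C]] measurable_emeasure_subprob_algebra[OF A[OF that]]
    by (rule measurable_compose)
  ultimately show "(\<lambda>\<mu>. emeasure (weighted_iid w \<mu>) B) \<in> borel_measurable (prob_algebra borel)"
    by (subst measurable_cong) (auto intro!: borel_measurable_prod_ennreal)
qed

section \<open>The directing measure\<close>

text \<open>The code \<open>\<phi>\<close> with decoder \<open>\<psi>\<close> reduces the construction of a random measure to that of a random
  distribution function, and \<open>nk\<close> is a sequence of indices along which averages converge almost
  surely.\<close>

locale coded_swappable_weights = swappable_weights P w c r
  for P :: "(nat \<Rightarrow> 'a::polish_space) measure" and w c r +
  fixes \<phi> :: "'a \<Rightarrow> real" and \<psi> :: "real \<Rightarrow> 'a" and nk :: "nat \<Rightarrow> nat"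
  assumes \<phi>_measurable [measurable]: "\<phi> \<in> borel_measurable borel"
    and \<psi>_measurable [measurable]: "\<psi> \<in> measurable borel borel"
    and \<psi>_\<phi>: "\<psi> (\<phi> y) = y" and \<phi>_nonneg: "0 \<le> \<phi> y" and \<phi>_less: "\<phi> y < 1"
    and nk: "4 ^ k \<le> r_sum (nk k)"
begin

definition below :: "real \<Rightarrow> 'a \<Rightarrow> real" where "below t y = indicator {..t} (\<phi> y)"

lemma below_measurable [measurable]: "below t \<in> borel_measurable borel"
  unfolding below_def by measurable

lemma below_bounds: "0 \<le> below t y" "below t y \<le> 1"
  by (auto simp: below_def indicator_def)

lemmas avg_below_bounds = avg_bounds[of "below t" for t, OF below_bounds]

text \<open>Upper limits are used because they exist at every point of the sequence space, are monotone in
  \<open>t\<close> and are invariant under swaps everywhere. Almost surely they are limits.\<close>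

definition lim_avg :: "real \<Rightarrow> (nat \<Rightarrow> 'a) \<Rightarrow> real" where
  "lim_avg t x = real_of_ereal (limsup (\<lambda>k. ereal (avg (nk k) (below t) x)))"

lemma ereal_lim_avg: "ereal (lim_avg t x) = limsup (\<lambda>k. ereal (avg (nk k) (below t) x))"
  and lim_avg_bounds: "0 \<le> lim_avg t x" "lim_avg t x \<le> 1"
proof -
  let ?l = "limsup (\<lambda>k. ereal (avg (nk k) (below t) x))"
  have "?l \<le> 1"
    by (intro Limsup_bounded always_eventually allI) (simp add: avg_below_bounds)
  moreover have "0 \<le> ?l"
    by (intro le_Limsup always_eventually allI) (simp_all add: avg_below_bounds)
  ultimately show "ereal (lim_avg t x) = ?l" "0 \<le> lim_avg t x" "lim_avg t x \<le> 1"
    unfolding lim_avg_def by (cases ?l; simp)+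
qed

lemma lim_avg_measurable [measurable]: "lim_avg t \<in> borel_measurable P"
  unfolding lim_avg_def by measurable

lemma lim_avg_mono: "mono (\<lambda>t. lim_avg t x)"
proof (rule monoI)
  fix t u :: real assume "t \<le> u"
  then have "below t y \<le> below u y" for y by (auto simp: below_def indicator_def)
  moreover have "0 \<le> coef_sum n x" for n
    unfolding coef_sum_def by (intro sum_nonneg) (simp add: coef_pos less_imp_le)
  ultimately have "avg n (below t) x \<le> avg n (below u) x" for n
    unfolding avg_def by (intro divide_right_mono sum_mono mult_left_mono) (auto simp: coef_pos less_imp_le)
  then have "ereal (lim_avg t x) \<le> ereal (lim_avg u x)"
    unfolding ereal_lim_avg by (intro Limsup_mono always_eventually allI) simp
  then show "lim_avg t x \<le> lim_avg u x" by simp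
qed

lemma lim_avg_neg: "t < 0 \<Longrightarrow> lim_avg t x = 0"
proof -
  assume "t < 0"
  then have "below t y = 0" for y using \<phi>_nonneg[of y] by (simp add: below_def)
  then have "avg n (below t) x = 0" for n by (simp add: avg_def)
  then show "lim_avg t x = 0" by (simp add: lim_avg_def Limsup_const)
qed

lemma r_sum_nk: "1 \<le> r_sum (nk k)"
  using nk[of k] one_le_power[of "4::real" k] by linarith

lemma lim_avg_ge_1: "1 \<le> t \<Longrightarrow> lim_avg t x = 1"
proof -
  assume "1 \<le> t"
  then have "below t y = 1" for y using \<phi>_less[of y] by (simp add: below_def)
  moreover have "coef_sum (nk k) x > 0" for k using r_sum_nk[of k] r_sum_le_coef_sum[of "nk k" x] by linarith
  then have "coef_sum (nk k) x \<noteq> 0" for k by (metis less_irrefl)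
  ultimately have "avg (nk k) (below t) x = 1" for k by (simp add: avg_def coef_sum_def)
  then show "lim_avg t x = 1" by (simp add: lim_avg_def Limsup_const)
qed

text \<open>The change of the averages under a swap tends to 0.\<close>

lemma lim_avg_swap: "lim_avg t (swap_coords i j x) = lim_avg t x"
proof -
  let ?d = "\<lambda>k. avg (nk k) (below t) (swap_coords i j x) - avg (nk k) (below t) x"
  have "?d \<longlonglongrightarrow> 0"
  proof (rule Lim_null_comparison)
    have "\<bar>?d k\<bar> \<le> 4 * (1 / 4) ^ k" for k
    proof -
      have "\<bar>?d k\<bar> \<le> 4 / r_sum (nk k)"
        using r_sum_nk[of k] by (intro avg_swap below_bounds) linarith
      also have "\<dots> \<le> 4 / 4 ^ k" using nk[of k] by (intro frac_le) auto
      finally show ?thesis by (simp add: power_one_over)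
    qed
    then show "eventually (\<lambda>k. norm (?d k) \<le> 4 * (1 / 4) ^ k) sequentially" by simp
    show "(\<lambda>k. 4 * (1 / 4 :: real) ^ k) \<longlonglongrightarrow> 0"
      by (rule tendsto_mult_right_zero, rule LIMSEQ_power_zero) simp
  qed
  then have "(\<lambda>k. ereal (?d k)) \<longlonglongrightarrow> ereal 0" by simp
  then have "limsup (\<lambda>k. ereal (?d k) + ereal (avg (nk k) (below t) x))
      = ereal 0 + limsup (\<lambda>k. ereal (avg (nk k) (below t) x))"
    by (rule ereal_limsup_lim_add) simp
  then show ?thesis by (simp add: lim_avg_def)
qed

lemma AE_LIMSEQ_avg: "AE x in P. (\<lambda>k. avg (nk k) (below t) x) \<longlonglongrightarrow> lim_avg t x"
  using AE_convergent_avg[OF nk below_measurable below_bounds]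
proof (rule AE_mp, intro AE_I2 impI)
  fix x assume "convergent (\<lambda>k. avg (nk k) (below t) x)"
  then obtain l where l: "(\<lambda>k. avg (nk k) (below t) x) \<longlonglongrightarrow> l" by (auto simp: convergent_def)
  then have "limsup (\<lambda>k. ereal (avg (nk k) (below t) x)) = ereal l"
    by (intro lim_imp_Limsup) auto
  then show "(\<lambda>k. avg (nk k) (below t) x) \<longlonglongrightarrow> lim_avg t x" using l by (simp add: lim_avg_def)
qed

definition cdf_lim :: "real \<Rightarrow> (nat \<Rightarrow> 'a) \<Rightarrow> real" where "cdf_lim t x = right_limit (\<lambda>u. lim_avg u x) t"

lemma LIMSEQ_cdf_lim: "(\<lambda>m. lim_avg (t + 1 / Suc m) x) \<longlonglongrightarrow> cdf_lim t x"
  unfolding cdf_lim_def by (rule right_limit_LIMSEQ[OF lim_avg_mono lim_avg_bounds(1)])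

lemma cdf_lim_measurable [measurable]: "cdf_lim t \<in> borel_measurable P"
  by (rule borel_measurable_LIMSEQ_real[OF LIMSEQ_cdf_lim]) measurable

lemma cdf_lim_bounds: "0 \<le> cdf_lim t x" "cdf_lim t x \<le> 1"
  using LIMSEQ_le_const[OF LIMSEQ_cdf_lim] LIMSEQ_le_const2[OF LIMSEQ_cdf_lim] lim_avg_bounds by blast+

definition coded_directing :: "(nat \<Rightarrow> 'a) \<Rightarrow> real measure" where
  "coded_directing x = interval_measure (right_limit (\<lambda>u. lim_avg u x))"

lemma emeasure_coded_directing: "emeasure (coded_directing x) {..t} = ennreal (cdf_lim t x)"
  unfolding coded_directing_def cdf_lim_def
  by (rule emeasure_right_limit[OF lim_avg_mono lim_avg_bounds(1) lim_avg_neg lim_avg_ge_1])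

lemma coded_directing_measurable [measurable]: "coded_directing \<in> measurable P (prob_algebra borel)"
proof (rule measurable_prob_algebra_generated)
  show "sets (borel :: real measure) = sigma_sets UNIV (range (\<lambda>t. {..t}))"
    unfolding borel_eq_atMost by simp
  show "Int_stable (range (\<lambda>t :: real. {..t}))"
    by (auto simp: Int_stable_def)
  have "real_distribution (coded_directing x)" for x
    unfolding coded_directing_def
    by (rule real_distribution_right_limit[OF lim_avg_mono lim_avg_bounds(1) lim_avg_neg lim_avg_ge_1])
  then show "prob_space (coded_directing x)" "sets (coded_directing x) = sets borel" for x
    by (auto simp: real_distribution_def real_distribution_axioms_def)
  fix A :: "real set" assume "A \<in> range (\<lambda>t. {..t})"
  then obtain t where "A = {..t}" by blast
  then show "(\<lambda>x. emeasure (coded_directing x) A) \<in> borel_measurable P"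
    by (simp add: emeasure_coded_directing)
qed auto

text \<open>Applying the decoder gives a probability measure on \<open>'a\<close> at every point, also at those where
  \<open>coded_directing\<close> charges reals that code no element of \<open>'a\<close>.\<close>

definition directing :: "(nat \<Rightarrow> 'a) \<Rightarrow> 'a measure" where
  "directing x = distr (coded_directing x) borel \<psi>"

lemma directing_measurable [measurable]: "directing \<in> measurable P (prob_algebra borel)"
  unfolding directing_def
  by (rule measurable_compose[OF coded_directing_measurable measurable_distr_prob_space[OF \<psi>_measurable]])

lemma directing_swap: "directing (swap_coords i j x) = directing x"
  by (simp add: directing_def coded_directing_def lim_avg_swap)

text \<open>The limit of \<open>avg_exchange_coordinate\<close> along the indices \<open>nk\<close>.\<close>

lemma lim_avg_exchange:
  fixes H :: "(nat \<Rightarrow> 'a) \<Rightarrow> real"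
  assumes H[measurable]: "H \<in> borel_measurable P" and H01: "\<And>x. 0 \<le> H x" "\<And>x. H x \<le> 1"
    and inv: "\<And>i x. m \<le> i \<Longrightarrow> H (swap_coords i j x) = H x"
  shows "(\<integral>x. H x * coef j (x j) * below t (x j) * lim_avg u x \<partial>P) = (\<integral>x. H x * coef j (x j) * below u (x j) * lim_avg t x \<partial>P)"
proof -
  have bound: "\<bar>H x * coef j (x j) * below t (x j) * y\<bar> \<le> 1" if "0 \<le> y" "y \<le> 1" for x t y
  proof -
    have "\<bar>H x * coef j (x j) * below t (x j) * y\<bar> \<le> 1 * 1 * 1 * 1"
      using H01 coef_le_1[of j "x j"] coef_pos[of j "x j"] below_bounds[of t "x j"] that
      by (intro abs_mult_le) auto
    then show ?thesis by simp
  qed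
  have lim: "(\<lambda>k. \<integral>x. H x * coef j (x j) * below t (x j) * avg (nk k) (below u) x \<partial>P)
      \<longlonglongrightarrow> (\<integral>x. H x * coef j (x j) * below t (x j) * lim_avg u x \<partial>P)" for t u
  proof (rule integral_dominated_convergence[where w = "\<lambda>_. 1"])
    show "AE x in P. (\<lambda>k. H x * coef j (x j) * below t (x j) * avg (nk k) (below u) x)
        \<longlonglongrightarrow> H x * coef j (x j) * below t (x j) * lim_avg u x"
      using AE_LIMSEQ_avg[of u] by (rule AE_mp) (auto intro!: AE_I2 tendsto_intros)
    show "AE x in P. norm (H x * coef j (x j) * below t (x j) * avg (nk k) (below u) x) \<le> 1" for k
      using bound avg_below_bounds by (intro AE_I2) simp
  qed auto
  have "(\<lambda>k. (\<integral>x. H x * coef j (x j) * below t (x j) * avg (nk k) (below u) x \<partial>P)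
      - (\<integral>x. H x * coef j (x j) * below u (x j) * avg (nk k) (below t) x \<partial>P)) \<longlonglongrightarrow> 0"
    (is "?d \<longlonglongrightarrow> 0")
  proof (rule Lim_null_comparison)
    have "\<bar>?d k\<bar> \<le> (2 + 4 * real m) * (1 / 4) ^ k" for k
    proof -
      have "\<bar>?d k\<bar> \<le> (2 + 4 * real m) / r_sum (nk k)"
        using H01 by (intro avg_exchange_coordinate below_bounds inv r_sum_nk) auto
      also have "\<dots> \<le> (2 + 4 * real m) / 4 ^ k"
        using nk[of k] r_sum_nk[of k] by (intro divide_left_mono) auto
      finally show ?thesis by (simp add: power_one_over)
    qed
    then show "eventually (\<lambda>k. norm (?d k) \<le> (2 + 4 * real m) * (1 / 4) ^ k) sequentially" by simp
    show "(\<lambda>k. (2 + 4 * real m) * (1 / 4) ^ k) \<longlonglongrightarrow> 0"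
      by (rule tendsto_mult_right_zero, rule LIMSEQ_power_zero) simp
  qed
  moreover have "?d \<longlonglongrightarrow> (\<integral>x. H x * coef j (x j) * below t (x j) * lim_avg u x \<partial>P)
      - (\<integral>x. H x * coef j (x j) * below u (x j) * lim_avg t x \<partial>P)"
    by (intro tendsto_diff lim)
  ultimately show ?thesis using LIMSEQ_unique by fastforce
qed

lemma cdf_lim_exchange:
  fixes H :: "(nat \<Rightarrow> 'a) \<Rightarrow> real"
  assumes H[measurable]: "H \<in> borel_measurable P" and H01: "\<And>x. 0 \<le> H x" "\<And>x. H x \<le> 1"
    and inv: "\<And>i x. m \<le> i \<Longrightarrow> H (swap_coords i j x) = H x"
  shows "(\<integral>x. H x * coef j (x j) * below t (x j) * cdf_lim u x \<partial>P) = (\<integral>x. H x * coef j (x j) * below u (x j) * cdf_lim t x \<partial>P)"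
proof -
  have below_lim: "(\<lambda>m. below (t + 1 / Suc m) y) \<longlonglongrightarrow> below t y" for t y
  proof (cases "\<phi> y \<le> t")
    case True
    then have "below (t + 1 / Suc m) y = below t y" for m
      using add_increasing2[of "1 / Suc m" "\<phi> y" t] by (simp add: below_def)
    then show ?thesis by simp
  next
    case False
    have "(\<lambda>m. t + 1 / Suc m) \<longlonglongrightarrow> t + 0"
      by (intro tendsto_intros lim_inverse_n'[THEN LIMSEQ_Suc])
    then have "eventually (\<lambda>m. t + 1 / Suc m < \<phi> y) sequentially"
      using False by (intro order_tendstoD(2)) auto
    then have "eventually (\<lambda>m. below (t + 1 / Suc m) y = below t y) sequentially"
      by eventually_elim (use False in \<open>auto simp: below_def\<close>)
    then show ?thesis by (rule tendsto_eventually)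
  qed
  have lim: "(\<lambda>m. \<integral>x. H x * coef j (x j) * below (t + 1 / Suc m) (x j) * lim_avg (u + 1 / Suc m) x \<partial>P)
      \<longlonglongrightarrow> (\<integral>x. H x * coef j (x j) * below t (x j) * cdf_lim u x \<partial>P)" for t u
  proof (rule integral_dominated_convergence[where w = "\<lambda>_. 1"])
    show "AE x in P. (\<lambda>m. H x * coef j (x j) * below (t + 1 / Suc m) (x j) * lim_avg (u + 1 / Suc m) x)
        \<longlonglongrightarrow> H x * coef j (x j) * below t (x j) * cdf_lim u x"
      by (intro AE_I2 tendsto_intros below_lim LIMSEQ_cdf_lim)
    show "AE x in P. norm (H x * coef j (x j) * below (t + 1 / Suc m) (x j) * lim_avg (u + 1 / Suc m) x) \<le> 1" for m
    proof (rule AE_I2)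
      fix x
      have "\<bar>H x * coef j (x j) * below (t + 1 / Suc m) (x j) * lim_avg (u + 1 / Suc m) x\<bar> \<le> 1 * 1 * 1 * 1"
        using H01 coef_le_1[of j "x j"] coef_pos[of j "x j"] below_bounds[of "t + 1 / Suc m" "x j"]
          lim_avg_bounds[of "u + 1 / Suc m" x]
        by (intro abs_mult_le) auto
      then show "norm (H x * coef j (x j) * below (t + 1 / Suc m) (x j) * lim_avg (u + 1 / Suc m) x) \<le> 1" by simp
    qed
  qed auto
  show ?thesis
    using lim[of t u] lim[of u t] lim_avg_exchange[OF H H01 inv] by (simp add: LIMSEQ_unique)
qed

text \<open>The identity for half-lines extends to all pairs of Borel functions on the line, and composing
  these with the decoder carries it back to \<open>'a\<close>.\<close>

lemma directing_exchange:
  fixes H :: "(nat \<Rightarrow> 'a) \<Rightarrow> real"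
  assumes H[measurable]: "H \<in> borel_measurable P" and H01: "\<And>x. 0 \<le> H x" "\<And>x. H x \<le> 1"
    and inv: "\<And>i x. m \<le> i \<Longrightarrow> H (swap_coords i j x) = H x"
    and f[measurable]: "f \<in> borel_measurable borel" and g[measurable]: "g \<in> borel_measurable borel"
  shows "(\<integral>\<^sup>+x. ennreal (H x * coef j (x j)) * f (x j) * (\<integral>\<^sup>+y. g y \<partial>directing x) \<partial>P)
    = (\<integral>\<^sup>+x. ennreal (H x * coef j (x j)) * g (x j) * (\<integral>\<^sup>+y. f y \<partial>directing x) \<partial>P)"
proof -
  have Ha: "0 \<le> H x * coef j (x j)" "H x * coef j (x j) \<le> 1" for x
    using H01[of x] coef_pos[of j "x j"] coef_le_1[of j "x j"] by (auto simp: less_imp_le intro: mult_le_one)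
  have conv: "(\<integral>\<^sup>+x. ennreal (H x * coef j (x j)) * indicator {..t} (\<phi> (x j)) * emeasure (coded_directing x) {..u} \<partial>P)
      = ennreal (\<integral>x. H x * coef j (x j) * below t (x j) * cdf_lim u x \<partial>P)" for t u
  proof -
    have "ennreal (H x * coef j (x j)) * indicator {..t} (\<phi> (x j)) * emeasure (coded_directing x) {..u}
      = ennreal (H x * coef j (x j) * below t (x j) * cdf_lim u x)" for x
      using Ha(1)[of x] cdf_lim_bounds(1)[of u x]
      by (simp add: emeasure_coded_directing below_def ennreal_mult' indicator_def)
    moreover have "integrable P (\<lambda>x. H x * coef j (x j) * below t (x j) * cdf_lim u x)"
    proof (rule bounded_integrable[where B = "1 * 1 * 1"])
      show "\<bar>H x * coef j (x j) * below t (x j) * cdf_lim u x\<bar> \<le> 1 * 1 * 1" for x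
        using Ha[of x] below_bounds[of t "x j"] cdf_lim_bounds[of u x] by (intro abs_mult_le) auto
    qed measurable
    moreover have "0 \<le> H x * coef j (x j) * below t (x j) * cdf_lim u x" for x
      using Ha(1)[of x] below_bounds[of t "x j"] cdf_lim_bounds[of u x] by simp
    ultimately show ?thesis by (simp add: nn_integral_eq_integral)
  qed
  have pull: "(\<integral>\<^sup>+y. h (\<psi> y) \<partial>coded_directing x) = (\<integral>\<^sup>+y. h y \<partial>directing x)"
    if "h \<in> borel_measurable borel" "x \<in> space P" for h x
  proof -
    have "sets (coded_directing x) = sets borel"
      using measurable_space[OF coded_directing_measurable that(2)] by (simp add: space_prob_algebra)
    then have "\<psi> \<in> measurable (coded_directing x) borel"
      using \<psi>_measurable measurable_cong_sets by blast
    then show ?thesis unfolding directing_def using that by (simp add: nn_integral_distr)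
  qed
  have "(\<integral>\<^sup>+x. ennreal (H x * coef j (x j)) * f (\<psi> (\<phi> (x j))) * (\<integral>\<^sup>+y. g (\<psi> y) \<partial>coded_directing x) \<partial>P)
    = (\<integral>\<^sup>+x. ennreal (H x * coef j (x j)) * g (\<psi> (\<phi> (x j))) * (\<integral>\<^sup>+y. f (\<psi> y) \<partial>coded_directing x) \<partial>P)"
  proof (rule kernel_symmetric_extend)
    show "finite_measure P" "space P \<noteq> {}" by (simp_all add: not_empty finite_measure_axioms)
    show "ennreal (H x * coef j (x j)) \<le> 1" for x using Ha[of x] by simp
    show "(\<integral>\<^sup>+x. ennreal (H x * coef j (x j)) * indicator {..t} (\<phi> (x j)) * emeasure (coded_directing x) {..u} \<partial>P)
      = (\<integral>\<^sup>+x. ennreal (H x * coef j (x j)) * indicator {..u} (\<phi> (x j)) * emeasure (coded_directing x) {..t} \<partial>P)" for u t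
      unfolding conv using cdf_lim_exchange[OF H H01 inv, where t = t and u = u] by simp
  qed measurable
  then show ?thesis by (simp add: pull \<psi>_\<phi> cong: nn_integral_cong)
qed

lemma sets_directing [simp]: "sets (directing x) = sets borel"
  and space_directing [simp]: "space (directing x) = UNIV"
  by (simp_all add: directing_def)

section \<open>The mixture representation\<close>

lemma space_P [simp]: "space P = UNIV"
  using sets_eq_imp_space_eq[OF sets_P] by (simp add: space_PiM)

lemma w_le: "w i y \<le> c i / r i"
  using r_w_le_c[of i y] r_pos[of i] by (simp add: pos_le_divide_eq mult.commute)

lemma directing_in_prob_algebra: "directing x \<in> space (prob_algebra borel)"
  using measurable_space[OF directing_measurable, of x] by simp

lemmas W_bounds = integral_weight_bounds[OF w_measurable c_pos c_le_w w_le directing_in_prob_algebra]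
lemmas W_nn_integral = nn_integral_weight[OF w_measurable c_pos c_le_w w_le directing_in_prob_algebra]
lemmas emeasure_tilted = emeasure_tilt[OF w_measurable c_pos c_le_w w_le directing_in_prob_algebra]
lemmas prob_space_tilted = prob_space_tilt[OF w_measurable c_pos c_le_w w_le directing_in_prob_algebra]

lemma tilted_measurable [measurable]:
  "(\<lambda>x. tilt (w j) (directing x)) \<in> measurable P (prob_algebra borel)"
  by (rule measurable_compose[OF directing_measurable tilt_measurable[OF w_measurable c_pos c_le_w w_le]])

text \<open>Take \<open>f = w j * indicator A\<close> and \<open>g = w j\<close> in \<open>directing_exchange\<close>. Since \<open>coef j y * w j y = c j\<close>
  for all \<open>y\<close>, the coordinate \<open>j\<close> disappears from the right-hand side, where only \<open>H\<close>, a constant and the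
  integral of \<open>w j * indicator A\<close> under the directing measure are left. Its normalisation \<open>W\<close> depends on the directing
  measure only, so it is invariant under swaps and can be absorbed into \<open>H\<close>.\<close>

lemma conditional_law_coordinate:
  fixes H :: "(nat \<Rightarrow> 'a) \<Rightarrow> real"
  assumes H[measurable]: "H \<in> borel_measurable P" and H01: "\<And>x. 0 \<le> H x" "\<And>x. H x \<le> 1"
    and inv: "\<And>i x. m \<le> i \<Longrightarrow> H (swap_coords i j x) = H x"
    and A[measurable]: "A \<in> sets borel"
  shows "(\<integral>\<^sup>+x. ennreal (H x) * indicator A (x j) \<partial>P)
    = (\<integral>\<^sup>+x. ennreal (H x) * emeasure (tilt (w j) (directing x)) A \<partial>P)"
proof -
  define W where "W x = (\<integral>y. w j y \<partial>directing x)" for x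
  have W: "c j \<le> W x" for x unfolding W_def by (rule W_bounds)
  have W0: "0 < W x" for x using W[of x] c_pos[of j] by linarith
  have [measurable]: "W \<in> borel_measurable P"
    unfolding W_def
    by (rule measurable_compose[OF measurable_prob_algebraD[OF directing_measurable]
          integral_measurable_subprob_algebra]) measurable
  \<comment> \<open>The factor \<open>c j\<close> keeps \<open>H'\<close> bounded by 1.\<close>
  define H' where "H' x = H x * (c j / W x)" for x
  have "(\<integral>\<^sup>+x. ennreal (H' x * coef j (x j)) * (ennreal (w j (x j)) * indicator A (x j)) * (\<integral>\<^sup>+y. ennreal (w j y) \<partial>directing x) \<partial>P)
    = (\<integral>\<^sup>+x. ennreal (H' x * coef j (x j)) * ennreal (w j (x j)) * (\<integral>\<^sup>+y. ennreal (w j y) * indicator A y \<partial>directing x) \<partial>P)"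
  proof (rule directing_exchange)
    show "H' \<in> borel_measurable P" unfolding H'_def by measurable
    show "0 \<le> H' x" for x using H01(1)[of x] W0[of x] c_pos[of j] by (simp add: H'_def)
    show "H' x \<le> 1" for x
      unfolding H'_def using H01[of x] W0[of x] W[of x] c_pos[of j] by (intro mult_le_one) auto
    show "H' (swap_coords i j x) = H' x" if "m \<le> i" for i x
      using that by (simp only: H'_def inv W_def directing_swap)
  qed measurable
  moreover have "ennreal (H' x * coef j (x j)) * (ennreal (w j (x j)) * indicator A (x j)) * (\<integral>\<^sup>+y. ennreal (w j y) \<partial>directing x)
      = ennreal (c j * c j) * (ennreal (H x) * indicator A (x j))" for x
  proof -
    have "(H' x * coef j (x j)) * w j (x j) * W x = (c j * c j) * H x"
      using W0[of x] w_pos[of j "x j"] by (simp add: H'_def coef_def)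
    then have "ennreal (H' x * coef j (x j)) * ennreal (w j (x j)) * ennreal (W x) = ennreal (c j * c j) * ennreal (H x)"
      using W0[of x] w_pos[of j "x j"] c_pos[of j] H01(1)[of x]
      by (simp flip: ennreal_mult'' add: less_imp_le)
    then show ?thesis unfolding W_nn_integral W_def[symmetric] by (simp add: ac_simps indicator_def)
  qed
  moreover have "ennreal (H' x * coef j (x j)) * ennreal (w j (x j)) * (\<integral>\<^sup>+y. ennreal (w j y) * indicator A y \<partial>directing x)
      = ennreal (c j * c j) * (ennreal (H x) * emeasure (tilt (w j) (directing x)) A)" for x
  proof -
    have "(H' x * coef j (x j)) * w j (x j) = (c j * c j) * (H x * (1 / W x))"
      using W0[of x] w_pos[of j "x j"] by (simp add: H'_def coef_def)
    then have "ennreal (H' x * coef j (x j)) * ennreal (w j (x j)) = ennreal (c j * c j) * (ennreal (H x) * ennreal (1 / W x))"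
      using W0[of x] w_pos[of j "x j"] c_pos[of j] H01(1)[of x]
      by (simp flip: ennreal_mult'' add: less_imp_le)
    then show ?thesis unfolding emeasure_tilted[OF A] W_def[symmetric] by (simp add: ac_simps)
  qed
  moreover have [measurable]: "(\<lambda>x. emeasure (tilt (w j) (directing x)) A) \<in> borel_measurable P"
    by (rule measurable_compose[OF measurable_prob_algebraD[OF tilted_measurable]
          measurable_emeasure_subprob_algebra[OF A]])
  ultimately have "ennreal (c j * c j) * (\<integral>\<^sup>+x. ennreal (H x) * indicator A (x j) \<partial>P)
      = ennreal (c j * c j) * (\<integral>\<^sup>+x. ennreal (H x) * emeasure (tilt (w j) (directing x)) A \<partial>P)"
    by (simp add: nn_integral_cmult)
  moreover have "ennreal (c j * c j) \<noteq> 0" using c_pos[of j] by simp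
  ultimately show ?thesis by (simp add: ennreal_mult_cancel_left)
qed

text \<open>The coordinates are replaced one at a time. Indicators of coordinates still to be replaced do
  not change when \<open>j\<close> is swapped with a large index; factors already replaced depend on
  the directing measure only and are collected in \<open>H\<close>.\<close>

lemma conditional_law_cylinder:
  fixes H :: "(nat \<Rightarrow> 'a) \<Rightarrow> real"
  assumes J: "finite J" and A: "\<And>l. l \<in> J \<Longrightarrow> A l \<in> sets borel"
    and H: "H \<in> borel_measurable P" "\<And>x. 0 \<le> H x" "\<And>x. H x \<le> 1" "\<And>i j x. H (swap_coords i j x) = H x"
  shows "(\<integral>\<^sup>+x. ennreal (H x) * (\<Prod>l\<in>J. indicator (A l) (x l)) \<partial>P)
    = (\<integral>\<^sup>+x. ennreal (H x) * (\<Prod>l\<in>J. emeasure (tilt (w l) (directing x)) (A l)) \<partial>P)"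
  using J A H
proof (induction J arbitrary: H rule: finite_induct)
  case (insert j J)
  note H = insert.prems(2-5) and [measurable] = insert.prems(2)
  have A[measurable]: "A l \<in> sets borel" if "l \<in> insert j J" for l using insert.prems(1) that .
  have [measurable]: "A j \<in> sets borel" using A by simp
  define G where "G x = H x * (\<Prod>l\<in>J. indicator (A l) (x l))" for x
  define T where "T x = measure (tilt (w j) (directing x)) (A j)" for x
  have T: "emeasure (tilt (w j) (directing x)) (A j) = ennreal (T x)" "0 \<le> T x" "T x \<le> 1" for x
    using prob_space_tilted[of j x] unfolding T_def
    by (auto simp: finite_measure.emeasure_eq_measure prob_space_def prob_space.prob_le_1)
  have Tm[measurable]: "T \<in> borel_measurable P" unfolding T_def
    by (rule measurable_compose[OF measurable_prob_algebraD[OF tilted_measurable]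
          measurable_measure_subprob_algebra]) simp
  have ind: "ennreal (\<Prod>l\<in>J. indicator (A l) (x l)) = (\<Prod>l\<in>J. indicator (A l) (x l))" for x
    by (simp add: prod_ennreal[symmetric] ennreal_indicator)
  have ind01: "0 \<le> (\<Prod>l\<in>J. indicator (A l) (x l) :: real)" "(\<Prod>l\<in>J. indicator (A l) (x l) :: real) \<le> 1" for x
    by (auto intro!: prod_nonneg prod_le_1)
  have G: "ennreal (G x) = ennreal (H x) * (\<Prod>l\<in>J. indicator (A l) (x l))" for x
    using H(2)[of x] by (simp add: G_def ennreal_mult' ind)
  obtain m where m: "\<And>l. l \<in> J \<Longrightarrow> l < m"
    using insert.hyps(1) by (auto simp: finite_nat_set_iff_bounded)
  have "(\<integral>\<^sup>+x. ennreal (H x) * (\<Prod>l\<in>insert j J. indicator (A l) (x l)) \<partial>P)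
      = (\<integral>\<^sup>+x. ennreal (G x) * indicator (A j) (x j) \<partial>P)"
    using insert.hyps by (simp add: G mult_ac)
  also have "\<dots> = (\<integral>\<^sup>+x. ennreal (G x) * emeasure (tilt (w j) (directing x)) (A j) \<partial>P)"
  proof (rule conditional_law_coordinate)
    have "(\<lambda>x. indicator (A l) (x l) :: real) \<in> borel_measurable P" if "l \<in> J" for l
    proof -
      have [measurable]: "A l \<in> sets borel" using that A by simp
      show ?thesis by measurable
    qed
    then show "G \<in> borel_measurable P" unfolding G_def
      by (intro borel_measurable_times borel_measurable_prod) auto
    show "0 \<le> G x" "G x \<le> 1" for x
      unfolding G_def using H(2,3)[of x] ind01[of x] by (auto intro: mult_le_one)
    fix i x assume "m \<le> i"
    then have "Transposition.transpose i j l = l" if "l \<in> J" for l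
      using m[OF that] insert.hyps(2) that by (intro transpose_apply_other) auto
    then show "G (swap_coords i j x) = G x"
      unfolding G_def H(4) by (intro arg_cong2[of _ _ _ _ "(*)"] prod.cong) auto
  qed simp
  also have "\<dots> = (\<integral>\<^sup>+x. ennreal (H x * T x) * (\<Prod>l\<in>J. indicator (A l) (x l)) \<partial>P)"
    using H(2) T(2) by (simp add: G T(1) ennreal_mult' mult_ac)
  also have "\<dots> = (\<integral>\<^sup>+x. ennreal (H x * T x) * (\<Prod>l\<in>J. emeasure (tilt (w l) (directing x)) (A l)) \<partial>P)"
  proof (rule insert.IH)
    show "A l \<in> sets borel" if "l \<in> J" for l using A that by simp
    show "0 \<le> H x * T x" "H x * T x \<le> 1" for x
      using H(2,3)[of x] T(2,3)[of x] by (auto intro: mult_le_one)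
    show "H (swap_coords i j' x) * T (swap_coords i j' x) = H x * T x" for i j' x
      by (simp only: H(4) T_def directing_swap)
  qed measurable
  also have "\<dots> = (\<integral>\<^sup>+x. ennreal (H x) * (\<Prod>l\<in>insert j J. emeasure (tilt (w l) (directing x)) (A l)) \<partial>P)"
    using insert.hyps H(2) T(2) by (simp add: T(1) ennreal_mult' mult_ac)
  finally show ?case .
qed simp

theorem is_weighted_iid_mixture: "weighted_iid_mixture w P"
proof -
  note iid = weighted_iid_measurable[OF w_measurable c_pos c_le_w w_le]
  have kernel[measurable]: "(\<lambda>x. weighted_iid w (directing x)) \<in> measurable P (prob_algebra seq_space)"
    by (rule measurable_compose[OF directing_measurable iid])
  have kernel': "(\<lambda>x. weighted_iid w (directing x)) \<in> measurable P (subprob_algebra seq_space)"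
    by (rule measurable_prob_algebraD[OF kernel])
  define Q where "Q = bind P (\<lambda>x. weighted_iid w (directing x))"
  have Q: "emeasure Q A = (\<integral>\<^sup>+x. emeasure (weighted_iid w (directing x)) A \<partial>P)" if "A \<in> sets seq_space" for A
    unfolding Q_def using kernel' that by (intro emeasure_bind) auto
  have "P = Q"
  proof (rule measure_eqI_PiM_infinite[where I = UNIV and M = "\<lambda>_. borel"])
    show "sets P = sets seq_space" by (rule sets_P)
    show "sets Q = sets seq_space"
      unfolding Q_def using subprob_measurableD(2)[OF kernel'] by (intro sets_bind) auto
    show "finite_measure P" by (rule finite_measure_axioms)
    fix A and J :: "nat set" assume J: "finite J" and A: "\<And>i. i \<in> J \<Longrightarrow> A i \<in> sets (borel :: 'a measure)"
    let ?B = "prod_emb UNIV (\<lambda>_. borel) J (Pi\<^sub>E J A)"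
    have B: "?B \<in> sets (seq_space :: (nat \<Rightarrow> 'a) measure)"
      using J A by (intro sets_PiM_I) auto
    then have "?B \<in> sets P" using sets_P by simp
    then have "emeasure P ?B = (\<integral>\<^sup>+x. indicator ?B x \<partial>P)" by simp
    also have "\<dots> = (\<integral>\<^sup>+x. ennreal 1 * (\<Prod>l\<in>J. indicator (A l) (x l)) \<partial>P)"
    proof (intro nn_integral_cong)
      fix x :: "nat \<Rightarrow> 'a"
      show "indicator ?B x = ennreal 1 * (\<Prod>l\<in>J. indicator (A l) (x l))"
      proof (cases "\<forall>l\<in>J. x l \<in> A l")
        case True
        then have "x \<in> ?B" by (auto simp: prod_emb_def PiE_iff)
        then show ?thesis using True by simp
      next
        case False
        then obtain l where l: "l \<in> J" "x l \<notin> A l" by blast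
        then have "x \<notin> ?B" by (auto simp: prod_emb_def PiE_iff)
        moreover have "(\<Prod>l\<in>J. indicator (A l) (x l) :: ennreal) = 0"
          using l by (intro prod_zero[OF J] bexI[of _ l]) simp_all
        ultimately show ?thesis by simp
      qed
    qed
    also have "\<dots> = (\<integral>\<^sup>+x. ennreal 1 * (\<Prod>l\<in>J. emeasure (tilt (w l) (directing x)) (A l)) \<partial>P)"
      by (rule conditional_law_cylinder[OF J A]) auto
    also have "\<dots> = (\<integral>\<^sup>+x. emeasure (weighted_iid w (directing x)) ?B \<partial>P)"
    proof (intro nn_integral_cong)
      fix x
      have "?B = prod_emb UNIV (\<lambda>i. tilt (w i) (directing x)) J (Pi\<^sub>E J A)"
        by (simp add: prod_emb_def tilt_def)
      then show "ennreal 1 * (\<Prod>l\<in>J. emeasure (tilt (w l) (directing x)) (A l))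
          = emeasure (weighted_iid w (directing x)) ?B"
        unfolding weighted_iid_def using prob_space_tilted J A by (simp add: emeasure_PiM_cylinder)
    qed
    finally show "emeasure P ?B = emeasure Q ?B" using Q[OF B] by simp
  qed
  have weak: "directing \<in> measurable P weak_borel"
    using directing_measurable measurable_cong_sets[OF refl sets_weak_borel] by blast
  show ?thesis
    unfolding weighted_iid_mixture_def
  proof (intro conjI exI ballI)
    show "sets P = sets seq_space" by (rule sets_P)
    show "prob_space (distr P weak_borel directing)" using weak by (rule prob_space_distr)
    show "sets (distr P weak_borel directing) = sets weak_borel" by simp
    fix A assume A: "A \<in> sets (seq_space :: (nat \<Rightarrow> 'a) measure)"
    have "(\<lambda>\<mu>. emeasure (weighted_iid w \<mu>) A) \<in> borel_measurable (prob_algebra borel)"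
      using measurable_prob_algebraD[OF iid] measurable_emeasure_subprob_algebra[OF A]
      by (rule measurable_compose)
    then have "(\<lambda>\<mu>. emeasure (weighted_iid w \<mu>) A) \<in> borel_measurable weak_borel"
      using measurable_cong_sets[OF sets_weak_borel refl] by blast
    then have "(\<integral>\<^sup>+\<mu>. emeasure (weighted_iid w \<mu>) A \<partial>distr P weak_borel directing)
        = (\<integral>\<^sup>+x. emeasure (weighted_iid w (directing x)) A \<partial>P)"
      using weak by (simp add: nn_integral_distr)
    also have "\<dots> = emeasure P A" using Q[OF A] \<open>P = Q\<close> by simp
    finally show "emeasure P A = (\<integral>\<^sup>+\<mu>. emeasure (weighted_iid w \<mu>) A \<partial>distr P weak_borel directing)" ..
  qed
qed

end

lemma partial_sums_diverge:
  fixes r :: "nat \<Rightarrow> real"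
  assumes "\<And>i. 0 \<le> r i" and "(\<Sum>i. ennreal (r i)) = \<infinity>"
  shows "filterlim (\<lambda>n. \<Sum>i<n. r i) at_top sequentially"
  unfolding filterlim_at_top
proof
  fix Z :: real
  have "ennreal Z < (SUP n. \<Sum>i<n. ennreal (r i))"
    using assms(2) by (metis suminf_eq_SUP ennreal_less_top infinity_ennreal_def)
  then obtain n where "ennreal Z < (\<Sum>i<n. ennreal (r i))" by (auto simp: less_SUP_iff)
  then have n: "Z < (\<Sum>i<n. r i)"
    using assms(1) by (simp add: sum_ennreal ennreal_less_iff sum_nonneg) (metis ennreal_leI not_less)
  have "Z \<le> (\<Sum>i<n'. r i)" if "n \<le> n'" for n'
  proof -
    have "(\<Sum>i<n. r i) \<le> (\<Sum>i<n'. r i)" using assms(1) that by (intro sum_mono2) auto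
    then show ?thesis using n by simp
  qed
  then show "eventually (\<lambda>n. Z \<le> (\<Sum>i<n. r i)) sequentially"
    by (auto simp: eventually_sequentially)
qed

theorem corollary4p2:
  fixes w :: "nat \<Rightarrow> 'a::polish_space \<Rightarrow> real"
    and P :: "(nat \<Rightarrow> 'a) measure"
  assumes "\<And>i. w i \<in> weight_funs"
    and "weighted_exchangeable w P"
    and "\<And>i. bounded (range (w i))"
    and "\<And>i. continuous_on UNIV (w i)"
    and "\<And>i. inf_sup_ratio (w i) > 0"
    and "(\<Sum>i. ennreal (inf_sup_ratio (w i))) = \<infinity>"
  shows "weighted_iid_mixture w P"
proof -
  define c where "c i = (INF y. w i y)" for i
  define r where "r i = inf_sup_ratio (w i)" for i
  have w_pos: "0 < w i y" and w_meas: "w i \<in> borel_measurable borel" for i y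
    using assms(1) by (auto simp: weight_funs_def)
  have above: "bdd_above (range (w i))" for i using assms(3) by (rule bounded_imp_bdd_above)
  have le_sup: "w i y \<le> (SUP y. w i y)" for i y by (rule cSUP_upper[OF UNIV_I above])
  have sup_pos: "0 < (SUP y. w i y)" for i using w_pos[of i undefined] le_sup[of i undefined] by linarith
  have c_le: "c i \<le> w i y" for i y
    unfolding c_def using w_pos by (intro cINF_lower bdd_belowI2[of _ 0]) (auto intro: less_imp_le)
  have r: "r i = c i / (SUP y. w i y)" "0 < r i" for i
    using assms(5)[of i] by (auto simp: r_def c_def inf_sup_ratio_def)
  have c_pos: "0 < c i" for i
    using r[of i] sup_pos[of i] by (simp add: zero_less_divide_iff)
  have r_w: "r i * w i y \<le> c i" for i y
  proof -
    have "r i * w i y \<le> r i * (SUP y. w i y)" using le_sup r(2)[of i] by (intro mult_left_mono) auto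
    also have "\<dots> = c i" using r(1)[of i] sup_pos[of i] by simp
    finally show ?thesis .
  qed
  have sets_P: "sets P = sets seq_space" and P: "prob_space P"
    using assms(2) by (auto simp: weighted_exchangeable_def)
  interpret prob_space P by (rule P)
  interpret swappable_weights P w c r
  proof unfold_locales
    show "filterlim (\<lambda>n. \<Sum>i<n. r i) at_top sequentially"
      using assms(5,6) unfolding r_def by (intro partial_sums_diverge) (auto intro: less_imp_le)
    show "distr (density P (\<lambda>x. ennreal (1 / (w i (x i) * w j (x j))))) seq_space (swap_coords i j)
        = density P (\<lambda>x. ennreal (1 / (w i (x i) * w j (x j))))" if "i \<noteq> j" for i j
      by (rule weighted_exchangeable_swap[OF assms(2,1) c_pos c_le that])
  qed (use sets_P w_meas c_pos r(2) c_le r_w in auto)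
  have "\<exists>n. 4 ^ k \<le> r_sum n" for k :: nat by (rule r_sum_unbounded)
  then obtain nk where nk: "\<And>k. 4 ^ k \<le> r_sum (nk k)" by metis
  obtain \<phi> :: "'a \<Rightarrow> real" and \<psi> where "\<phi> \<in> borel_measurable borel" "\<psi> \<in> measurable borel borel"
    "\<And>x. \<psi> (\<phi> x) = x" "\<And>x. 0 \<le> \<phi> x" "\<And>x. \<phi> x < 1"
    using polish_real_code by blast
  with nk interpret coded_swappable_weights P w c r \<phi> \<psi> nk
    by unfold_locales auto
  show ?thesis by (rule is_weighted_iid_mixture)
qed

end
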